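(* Let $A$ be an associative algebra, $M$ an $A$-bimodule and $P:M\to A$ a relative averaging operator (i.e. $M\xrightarrow{P}A$ is a relative averaging algebra). Then there is a long exact sequence $$\cdots\to H^{n-1}_P(M,A)\to H^n_{\mathrm{rAvg}}(M\xrightarrow{P}A)\to H^n_{\mathrm{AssBimod}}({}^AM^A,{}^AM^A)\to H^n_P(M,A)\to\cdots$$
   Context: Everything is over a field $\mathbf k$ of characteristic $0$. $\cdot$ is the product of $A$ (also written $\mu$) and $\cdot_M$ denotes both $A$-actions on $M$. A relative averaging operator is a linear map $P:M\to A$ with $P(u)\cdot P(v)=P(P(u)\cdot_M v)=P(u\cdot_M P(v))$ for all $u,v\in M$; the triple $(A,M,P)$ is then called a relative averaging algebra and is denoted $M\xrightarrow{P}A$. Trees. $Y_n$ ($n\ge 1$) is the set of planar binary trees with $n$ trivalent vertices, one root and $n+1$ leaves labelled $0,\dots,n$ from left to right; $Y_0=\{|\}$. $y_1\vee y_2$ denotes grafting ($y_1$ on the left) at a new root vertex. $d_i:Y_n\to Y_{n-1}$ deletes the $i$-th leaf. For $y\in Y_n$, $n\ge1$: $\star_0^y=\dashv$ if $y=|\vee y_1$ for some $y_1\in Y_{n-1}$ and $\vdash$ otherwise; for $1\le i\le n-1$, $\star_i^y=\dashv$ if the $i$-th leaf is oriented like $\backslash$ (a left child of its vertex) and $\vdash$ if oriented like $/$ (a right child); $\star_n^y=\vdash$ if $y=y_1\vee|$ for some $y_1\in Y_{n-1}$ and $\dashv$ otherwise. Cohomology of $P$. $CY^n(M,A)=\mathrm{Hom}(\mathbf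 k[Y_n]\otimes M^{\otimes n},A)$, $n\ge0$, with differential $$\delta^P_{\mathrm{Diass}}(\gamma)(y;u_1,\dots,u_{n+1})=u_1\star_0^y\gamma(d_0y;u_2,\dots,u_{n+1})+\sum_{i=1}^n(-1)^i\gamma(d_iy;u_1,\dots,u_i(\star_i^y)_Pu_{i+1},\dots,u_{n+1})+(-1)^{n+1}\gamma(d_{n+1}y;u_1,\dots,u_n)\star_{n+1}^yu_{n+1},$$ where $u\dashv_Pv=u\cdot_MP(v)$, $u\vdash_Pv=P(u)\cdot_Mv$ and, for $u\in M,a\in A$: $u\dashv a=P(u)\cdot a-P(u\cdot_Ma)$, $u\vdash a=P(u)\cdot a$, $a\dashv u=a\cdot P(u)$, $a\vdash u=a\cdot P(u)-P(a\cdot_Mu)$. Its cohomology (the cohomology of the operator $P$) is $H^n_P(M,A)$. Cohomology of the associative bimodule. Let $\mathcal A^{n-1,1}$ be the direct sum of all tensor products of $n-1$ copies of $A$ and one copy of $M$, in any order. $C^0_{\mathrm{AssBimod}}=0$ and $C^n_{\mathrm{AssBimod}}=\mathrm{Hom}(A^{\otimes n},A)\oplus\mathrm{Hom}(\mathcal A^{n-1,1},M)$ for $n\ge1$, with $\delta_{\mathrm{AssBimod}}(f,g)=(\delta_{\mathrm{Hoch}}(f),\delta^f_{\mathrm{Hoch}}(g))$, where $\delta_{\mathrm{Hoch}}$ is the Hochschild coboundary of $A$ with coefficients in $A$ and, for $a_1\otimes\cdots\otimes a_{n+1}\in\mathcal A^{n,1}$, $$\delta^f_{\mathrm{Hoch}}(g)(a_1,\dots,a_{n+1})=a_1\cdot_M(f+g)(a_2,\dots,a_{n+1})+\sum_{i=1}^n(-1)^ig(a_1,\dots,a_{i-1},(\mu+\cdot_M)(a_i,a_{i+1}),\dots,a_{n+1})+(-1)^{n+1}(f+g)(a_1,\dots,a_n)\cdot_Ma_{n+1}$$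 ($f$ is applied when all arguments lie in $A$, $g$ when exactly one lies in $M$). Its cohomology is $H^n_{\mathrm{AssBimod}}({}^AM^A,{}^AM^A)$. Cohomology of the relative averaging algebra. $C^0_{\mathrm{rAvg}}=0$, $C^1_{\mathrm{rAvg}}=\mathrm{Hom}(A,A)\oplus\mathrm{Hom}(M,M)$, and $C^n_{\mathrm{rAvg}}=\mathrm{Hom}(A^{\otimes n},A)\oplus\mathrm{Hom}(\mathcal A^{n-1,1},M)\oplus\mathrm{Hom}(\mathbf k[Y_{n-1}]\otimes M^{\otimes n-1},A)$ for $n\ge2$, with $$\delta_{\mathrm{rAvg}}(f,g,\gamma)=\big(\delta_{\mathrm{Hoch}}(f),\ \delta^f_{\mathrm{Hoch}}(g),\ \delta^P_{\mathrm{Diass}}(\gamma)+h_P(f,g)\big)$$ ($\gamma=0$ when $n=1$), where for $y=y_1\vee y_2\in Y_n$ with $y_1\in Y_{i-1}$, $y_2\in Y_{n-i}$, $$h_P(f,g)(y;u_1,\dots,u_n)=(-1)^n\big\{f(P(u_1),\dots,P(u_n))-P\,g(P(u_1),\dots,P(u_{i-1}),u_i,P(u_{i+1}),\dots,P(u_n))\big\}.$$ Its cohomology is $H^n_{\mathrm{rAvg}}(M\xrightarrow{P}A)$.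
   Formalization: Exactness is stated at H^n_rAvg and H^n_P for n≥1 and at H^n_AssBimod for n≥2; it is not claimed at H^0_P and H^1_AssBimod, where it fails, e.g. for A=M=M_2(k) with P the projection onto diagonal matrices. *)

theory Defs
  imports
    Complex_Main
    "HOL-Algebra.Module"
    "HOL-Algebra.AbelCoset"
    "HOL-Library.Function_Algebras"
    "HOL-Library.Product_Plus"
    "HOL-Library.Set_Algebras"
begin

section \<open>Relative averaging algebras\<close>

text \<open>Algebras are associative but not assumed unital (class \<^class>\<open>ring\<close>); the field
  acts through an explicit scalar multiplication.\<close>

locale assoc_algebra = A: vector_space scaleA
  for scaleA :: "'k::field \<Rightarrow> 'a::ring \<Rightarrow> 'a" +
  assumes scale_mult_left: "scaleA c x * y = scaleA c (x * y)"
    and scale_mult_right: "x * scaleA c y = scaleA c (x * y)"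

locale assoc_bimodule = assoc_algebra scaleA + M: vector_space scaleM
  for scaleA :: "'k::field \<Rightarrow> 'a::ring \<Rightarrow> 'a"
    and scaleM :: "'k \<Rightarrow> 'm::ab_group_add \<Rightarrow> 'm" +
  fixes lact :: "'a \<Rightarrow> 'm \<Rightarrow> 'm"
    and ract :: "'m \<Rightarrow> 'a \<Rightarrow> 'm"
  assumes lact_linear_alg: "Vector_Spaces.linear scaleA scaleM (\<lambda>a. lact a u)"
    and lact_linear_mod: "Vector_Spaces.linear scaleM scaleM (\<lambda>u. lact a u)"
    and ract_linear_mod: "Vector_Spaces.linear scaleM scaleM (\<lambda>u. ract u a)"
    and ract_linear_alg: "Vector_Spaces.linear scaleA scaleM (\<lambda>a. ract u a)"
    and lact_mult: "lact (a * b) u = lact a (lact b u)"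
    and ract_mult: "ract u (a * b) = ract (ract u a) b"
    and lact_ract: "ract (lact a u) b = lact a (ract u b)"

locale relative_averaging_algebra = assoc_bimodule scaleA scaleM lact ract
  for scaleA :: "'k::field \<Rightarrow> 'a::ring \<Rightarrow> 'a"
    and scaleM :: "'k \<Rightarrow> 'm::ab_group_add \<Rightarrow> 'm"
    and lact :: "'a \<Rightarrow> 'm \<Rightarrow> 'm"
    and ract :: "'m \<Rightarrow> 'a \<Rightarrow> 'm" +
  fixes P :: "'m \<Rightarrow> 'a"
  assumes P_linear: "Vector_Spaces.linear scaleM scaleA P"
    and averaging_left: "P u * P v = P (lact (P u) v)"
    and averaging_right: "P u * P v = P (ract u (P v))"


section \<open>Planar binary trees\<close>

text \<open>\<open>Node l r\<close> is the grafting of \<open>l\<close> and \<open>r\<close>, so \<open>Y n\<close> consists of the trees with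
  \<open>n\<close> trivalent vertices; their leaves are numbered \<open>0, \<dots>, n\<close> from left to right. In
  \<open>Node l r\<close> the leaves \<open>0, \<dots>, vertices l\<close> belong to \<open>l\<close>.\<close>

datatype pbtree = Leaf | Node pbtree pbtree

fun vertices :: "pbtree \<Rightarrow> nat" where
  "vertices Leaf = 0"
| "vertices (Node l r) = vertices l + vertices r + 1"

definition Y :: "nat \<Rightarrow> pbtree set" where
  "Y n = {y. vertices y = n}"

text \<open>Deleting a leaf removes its parent vertex and puts the sibling subtree in its place.
  The value at the one-leaf tree is a dummy.\<close>

fun del_leaf :: "nat \<Rightarrow> pbtree \<Rightarrow> pbtree" where
  "del_leaf i Leaf = Leaf"
| "del_leaf i (Node l r) =
    (if i \<le> vertices l
     then (if l = Leaf then r else Node (del_leaf i l) r)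
     else (if r = Leaf then l else Node l (del_leaf (i - vertices l - 1) r)))"

fun is_left_leaf :: "nat \<Rightarrow> pbtree \<Rightarrow> bool" where
  "is_left_leaf i Leaf = False"
| "is_left_leaf i (Node l r) =
    (if i \<le> vertices l
     then l = Leaf \<or> is_left_leaf i l
     else r \<noteq> Leaf \<and> is_left_leaf (i - vertices l - 1) r)"

datatype diass_op = Dashv | Vdash

definition star :: "nat \<Rightarrow> pbtree \<Rightarrow> diass_op" where
  "star i y =
    (if i = 0 then (if \<exists>y1. y = Node Leaf y1 then Dashv else Vdash)
     else if i = vertices y then (if \<exists>y1. y = Node y1 Leaf then Vdash else Dashv)
     else (if is_left_leaf i y then Dashv else Vdash))"


section \<open>Cochain complexes and their cohomology\<close>

text \<open>A complex of subspaces \<open>cochains K n\<close> of one ambient vector space.\<close>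

record ('k, 'c) cochain_complex =
  cochains :: "nat \<Rightarrow> 'c set"
  differential :: "nat \<Rightarrow> 'c \<Rightarrow> 'c"
  scaling :: "'k \<Rightarrow> 'c \<Rightarrow> 'c"

definition cocycles :: "('k, 'c::ab_group_add) cochain_complex \<Rightarrow> nat \<Rightarrow> 'c set" where
  "cocycles K n = {z \<in> cochains K n. differential K n z = 0}"

definition coboundaries :: "('k, 'c::ab_group_add) cochain_complex \<Rightarrow> nat \<Rightarrow> 'c set" where
  "coboundaries K n = (if n = 0 then {0} else differential K (n - 1) ` cochains K (n - 1))"

definition coh_class :: "('k, 'c::ab_group_add) cochain_complex \<Rightarrow> nat \<Rightarrow> 'c \<Rightarrow> 'c set" where
  "coh_class K n z = z +o coboundaries K n"

text \<open>The quotient of cocycles by coboundaries, as a space of cosets. Adding the coboundaries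
  in the scalar multiplication matters only for the scalar 0. The ring multiplication that the
  record type \<^typ>\<open>('k, 'c) module\<close> carries along has no meaning for a vector space.\<close>

definition cohomology :: "('k, 'c::ab_group_add) cochain_complex \<Rightarrow> nat \<Rightarrow> ('k, 'c set) module"
  where
  "cohomology K n =
    \<lparr>carrier = coh_class K n ` cocycles K n,
     monoid.mult = undefined,
     one = undefined,
     zero = coboundaries K n,
     add = (\<lambda>X Z. X + Z),
     smult = (\<lambda>c X. scaling K c ` X + coboundaries K n)\<rparr>"

definition linear_map :: "('k, 'c) module \<Rightarrow> ('k, 'd) module \<Rightarrow> ('c \<Rightarrow> 'd) \<Rightarrow> bool" where
  "linear_map V W \<phi> \<longleftrightarrow> abelian_group_hom V W \<phi> \<and>
     (\<forall>c. \<forall>x\<in>carrier V. \<phi> (c \<odot>\<^bsub>V\<^esub> x) = c \<odot>\<^bsub>W\<^esub> \<phi> x)"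

definition exact_at ::
  "('k, 'c) module \<Rightarrow> ('c \<Rightarrow> 'd) \<Rightarrow> ('k, 'd) module \<Rightarrow> ('d \<Rightarrow> 'e) \<Rightarrow> ('k, 'e) module \<Rightarrow> bool"
  where
  "exact_at U \<phi> V \<psi> W \<longleftrightarrow> \<phi> ` carrier U = a_kernel V W \<psi>"


section \<open>Multilinear cochains\<close>

text \<open>Linear maps out of a tensor power are rendered as multilinear functions of the list of
  arguments; they are normalised to vanish on lists of the wrong length (or shape, or on trees
  of the wrong size), so that two cochains are equal iff they agree on all proper arguments.\<close>

definition multilinear ::
  "('k::field \<Rightarrow> 'v::ab_group_add \<Rightarrow> 'v) \<Rightarrow> ('k \<Rightarrow> 'w::ab_group_add \<Rightarrow> 'w) \<Rightarrow> nat \<Rightarrow>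
   ('v list \<Rightarrow> 'w) \<Rightarrow> bool" where
  "multilinear scaleV scaleW n f \<longleftrightarrow>
     (\<forall>xs. length xs \<noteq> n \<longrightarrow> f xs = 0) \<and>
     (\<forall>xs. length xs = n \<longrightarrow>
        (\<forall>i<n. Vector_Spaces.linear scaleV scaleW (\<lambda>x. f (xs[i := x]))))"

text \<open>A word of length \<open>n\<close> with letters in \<open>A\<close> (\<^const>\<open>Inl\<close>) and exactly one letter in
  \<open>M\<close> (\<^const>\<open>Inr\<close>) is a pure tensor in one of the \<open>n\<close> summands of the sum of all tensor
  products of \<open>n - 1\<close> copies of \<open>A\<close> and one copy of \<open>M\<close>.\<close>

definition mixed_words :: "nat \<Rightarrow> ('a + 'm) list set" where
  "mixed_words n = {w. length w = n \<and> length (filter (\<lambda>x. \<not> isl x) w) = 1}"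

definition mixed_multilinear ::
  "('k::field \<Rightarrow> 'a::ab_group_add \<Rightarrow> 'a) \<Rightarrow> ('k \<Rightarrow> 'm::ab_group_add \<Rightarrow> 'm) \<Rightarrow> nat \<Rightarrow>
   (('a + 'm) list \<Rightarrow> 'm) \<Rightarrow> bool" where
  "mixed_multilinear scaleA scaleM n g \<longleftrightarrow>
     (\<forall>w. w \<notin> mixed_words n \<longrightarrow> g w = 0) \<and>
     (\<forall>w\<in>mixed_words n. \<forall>i<n.
        (if isl (w ! i) then Vector_Spaces.linear scaleA scaleM (\<lambda>a. g (w[i := Inl a]))
         else Vector_Spaces.linear scaleM scaleM (\<lambda>u. g (w[i := Inr u]))))"


section \<open>The three complexes\<close>

text \<open>In the differentials below, the argument written \<open>a_i\<close> (counting from 1) on paper is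
  the list entry with index \<open>i - 1\<close>. Signs are applied through the scalar multiplication since
  \<open>A\<close> has no unit.\<close>

context
  fixes scaleA :: "'k::field \<Rightarrow> 'a::ring \<Rightarrow> 'a"
    and scaleM :: "'k \<Rightarrow> 'm::ab_group_add \<Rightarrow> 'm"
    and lact :: "'a \<Rightarrow> 'm \<Rightarrow> 'm"
    and ract :: "'m \<Rightarrow> 'a \<Rightarrow> 'm"
    and P :: "'m \<Rightarrow> 'a"
begin

subsection \<open>The averaging operator\<close>

fun diass_P :: "diass_op \<Rightarrow> 'm \<Rightarrow> 'm \<Rightarrow> 'm" where
  "diass_P Dashv u v = ract u (P v)"
| "diass_P Vdash u v = lact (P u) v"

fun diass_left :: "diass_op \<Rightarrow> 'm \<Rightarrow> 'a \<Rightarrow> 'a" where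
  "diass_left Dashv u a = P u * a - P (ract u a)"
| "diass_left Vdash u a = P u * a"

fun diass_right :: "diass_op \<Rightarrow> 'a \<Rightarrow> 'm \<Rightarrow> 'a" where
  "diass_right Dashv a u = a * P u"
| "diass_right Vdash a u = a * P u - P (lact a u)"

definition CY :: "nat \<Rightarrow> (pbtree \<Rightarrow> 'm list \<Rightarrow> 'a) set" where
  "CY n = {\<gamma>. (\<forall>y. y \<notin> Y n \<longrightarrow> \<gamma> y = 0) \<and> (\<forall>y\<in>Y n. multilinear scaleM scaleA n (\<gamma> y))}"

definition delta_P :: "nat \<Rightarrow> (pbtree \<Rightarrow> 'm list \<Rightarrow> 'a) \<Rightarrow> (pbtree \<Rightarrow> 'm list \<Rightarrow> 'a)" where
  "delta_P n \<gamma> = (\<lambda>y us.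
     if y \<in> Y (n + 1) \<and> length us = n + 1 then
       diass_left (star 0 y) (us ! 0) (\<gamma> (del_leaf 0 y) (drop 1 us))
       + (\<Sum>i = 1..n. scaleA ((-1) ^ i)
            (\<gamma> (del_leaf i y)
               (take (i - 1) us @ [diass_P (star i y) (us ! (i - 1)) (us ! i)] @ drop (i + 1) us)))
       + scaleA ((-1) ^ (n + 1))
            (diass_right (star (n + 1) y) (\<gamma> (del_leaf (n + 1) y) (take n us)) (us ! n))
     else 0)"

definition complex_P :: "('k, pbtree \<Rightarrow> 'm list \<Rightarrow> 'a) cochain_complex" where
  "complex_P = \<lparr>cochains = CY, differential = delta_P, scaling = (\<lambda>c \<gamma> y us. scaleA c (\<gamma> y us))\<rparr>"


subsection \<open>The associative bimodule\<close>

definition delta_Hoch :: "nat \<Rightarrow> ('a list \<Rightarrow> 'a) \<Rightarrow> ('a list \<Rightarrow> 'a)" where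
  "delta_Hoch n f = (\<lambda>as.
     if length as = n + 1 then
       as ! 0 * f (drop 1 as)
       + (\<Sum>i = 1..n. scaleA ((-1) ^ i)
            (f (take (i - 1) as @ [as ! (i - 1) * as ! i] @ drop (i + 1) as)))
       + scaleA ((-1) ^ (n + 1)) (f (take n as) * as ! n)
     else 0)"

text \<open>\<open>letter_mult\<close> is the product \<open>\<mu> + \<cdot>\<^sub>M\<close> of letters. Two adjacent letters from \<open>M\<close> never
  occur in a mixed word; that value is a dummy.\<close>

fun letter_mult :: "'a + 'm \<Rightarrow> 'a + 'm \<Rightarrow> 'a + 'm" where
  "letter_mult (Inl a) (Inl b) = Inl (a * b)"
| "letter_mult (Inl a) (Inr u) = Inr (lact a u)"
| "letter_mult (Inr u) (Inl a) = Inr (ract u a)"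
| "letter_mult (Inr u) (Inr v) = Inr 0"

definition apply_sum ::
  "('a list \<Rightarrow> 'a) \<Rightarrow> (('a + 'm) list \<Rightarrow> 'm) \<Rightarrow> ('a + 'm) list \<Rightarrow> 'a + 'm" where
  "apply_sum f g w = (if \<forall>x\<in>set w. isl x then Inl (f (map projl w)) else Inr (g w))"

definition delta_Hoch_rel ::
  "nat \<Rightarrow> ('a list \<Rightarrow> 'a) \<Rightarrow> (('a + 'm) list \<Rightarrow> 'm) \<Rightarrow> (('a + 'm) list \<Rightarrow> 'm)" where
  "delta_Hoch_rel n f g = (\<lambda>w.
     if w \<in> mixed_words (n + 1) then
       projr (letter_mult (w ! 0) (apply_sum f g (drop 1 w)))
       + (\<Sum>i = 1..n. scaleM ((-1) ^ i)
            (g (take (i - 1) w @ [letter_mult (w ! (i - 1)) (w ! i)] @ drop (i + 1) w)))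
       + scaleM ((-1) ^ (n + 1)) (projr (letter_mult (apply_sum f g (take n w)) (w ! n)))
     else 0)"

definition C_AssBimod :: "nat \<Rightarrow> (('a list \<Rightarrow> 'a) \<times> (('a + 'm) list \<Rightarrow> 'm)) set" where
  "C_AssBimod n =
    (if n = 0 then {0}
     else {f. multilinear scaleA scaleA n f} \<times> {g. mixed_multilinear scaleA scaleM n g})"

definition complex_AssBimod ::
  "('k, ('a list \<Rightarrow> 'a) \<times> (('a + 'm) list \<Rightarrow> 'm)) cochain_complex" where
  "complex_AssBimod =
    \<lparr>cochains = C_AssBimod,
     differential = (\<lambda>n (f, g). (delta_Hoch n f, delta_Hoch_rel n f g)),
     scaling = (\<lambda>c (f, g). (\<lambda>as. scaleA c (f as), \<lambda>w. scaleM c (g w)))\<rparr>"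


subsection \<open>The relative averaging algebra\<close>

text \<open>For \<open>y = Node y1 y2\<close> with \<open>y1 \<in> Y (i - 1)\<close>, the argument in position \<open>i\<close>, which is
  not hit by \<open>P\<close> inside \<open>g\<close>, is the list entry with index \<open>i - 1 = vertices y1\<close>.\<close>

definition h_P ::
  "nat \<Rightarrow> ('a list \<Rightarrow> 'a) \<Rightarrow> (('a + 'm) list \<Rightarrow> 'm) \<Rightarrow> (pbtree \<Rightarrow> 'm list \<Rightarrow> 'a)" where
  "h_P n f g = (\<lambda>y us.
     if y \<in> Y n \<and> length us = n then
       (case y of
          Leaf \<Rightarrow> 0
        | Node y1 y2 \<Rightarrow>
            scaleA ((-1) ^ n)
              (f (map P us)
               - P (g ((map (\<lambda>u. Inl (P u)) us)[vertices y1 := Inr (us ! vertices y1)]))))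
     else 0)"

definition C_rAvg ::
  "nat \<Rightarrow> (('a list \<Rightarrow> 'a) \<times> (('a + 'm) list \<Rightarrow> 'm) \<times> (pbtree \<Rightarrow> 'm list \<Rightarrow> 'a)) set" where
  "C_rAvg n =
    (if n = 0 then {0}
     else {f. multilinear scaleA scaleA n f} \<times> {g. mixed_multilinear scaleA scaleM n g} \<times>
          (if n = 1 then {0} else CY (n - 1)))"

text \<open>In degree 0 the differential below is only ever applied to \<open>0\<close>.\<close>

definition complex_rAvg ::
  "('k, ('a list \<Rightarrow> 'a) \<times> (('a + 'm) list \<Rightarrow> 'm) \<times> (pbtree \<Rightarrow> 'm list \<Rightarrow> 'a)) cochain_complex"
  where
  "complex_rAvg =
    \<lparr>cochains = C_rAvg,
     differential = (\<lambda>n (f, g, \<gamma>).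
       (delta_Hoch n f, delta_Hoch_rel n f g, delta_P (n - 1) \<gamma> + h_P n f g)),
     scaling = (\<lambda>c (f, g, \<gamma>).
       (\<lambda>as. scaleA c (f as), \<lambda>w. scaleM c (g w), \<lambda>y us. scaleA c (\<gamma> y us)))\<rparr>"

end

end

theory Submission
  imports Defs
begin

text \<open>The complex of a relative averaging algebra is, up to signs, the mapping cone of \<open>h_P\<close>,
  truncated in degree 1 because \<open>CY 0\<close> is left out. That \<open>h_P\<close> anticommutes with the
  differentials is checked summand by summand: the two neighbours of the root among the inner
  leaves carry exactly the operations that turn the letter from \<open>M\<close> into the merged letter,
  and the extra terms of the outer actions cancel by the averaging identity. Despite
  the truncation, \<open>(0, 0, \<delta>_P a)\<close> is a coboundary for \<open>a \<in> CY 0\<close>, because \<open>\<delta>_P a = h_P (ad a)\<close>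
  for the inner derivation \<open>ad a\<close> of the bimodule.\<close>

section \<open>Induced maps on cohomology\<close>

text \<open>The kernel of \<open>\<pi>_map\<close> is the complex of \<open>P\<close> shifted by one
  with \<open>CY 0\<close> removed. In its lowest degree the cohomology of that kernel is the space
  of all 1-cocycles of \<open>P\<close>, not its quotient by \<open>delta_P\<close> of
  \<open>CY 0\<close>. The zigzag argument for a short exact sequence of complexes would thus give a
  different sequence in low degrees, so well-definedness and exactness are verified on
  representatives, one degree at a time. The connecting map is still the one that the zigzag
  predicts: a cocycle \<open>(f, g)\<close> lifts to \<open>(f, g, 0)\<close>, whose differential is
  \<open>(0, 0, h_P f g)\<close>. Inner derivations repair the place \<open>H^1_P\<close>, but they
  also spoil the place \<open>H^1_AssBimod\<close>. There they are not coboundaries, since the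
  degree 0 cochains vanish; their image under \<open>h_P\<close> is a coboundary, yet they lift to a
  cocycle of the relative averaging complex only if that image is zero. This is why exactness at
  \<open>KB\<close> starts in degree 2.\<close>

lemma elt_set_plus_image: "x +o B = (+) x ` B"
  by (auto simp: elt_set_plus_def)

lemma coset_eq_iff_diff:
  fixes B :: "'c::ab_group_add set"
  assumes "0 \<in> B" "\<And>x y. x \<in> B \<Longrightarrow> y \<in> B \<Longrightarrow> x - y \<in> B"
  shows "x +o B = y +o B \<longleftrightarrow> x - y \<in> B"
proof
  assume "x +o B = y +o B"
  moreover have "x \<in> x +o B"
    using assms(1) by (force simp: elt_set_plus_def)
  ultimately show "x - y \<in> B"
    by (auto simp: elt_set_plus_def)
next
  assume xy: "x - y \<in> B"
  have add: "a + b \<in> B" if "a \<in> B" "b \<in> B" for a b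
    using assms(2)[OF that(1) assms(2)[OF assms(1) that(2)]] by simp
  have "x + b = y + ((x - y) + b)" "y + b = x + (b - (x - y))" for b
    by simp_all
  with xy add assms(2) show "x +o B = y +o B"
    unfolding elt_set_plus_def by blast
qed

text \<open>Coboundaries need not be cocycles here; the carrier of the cohomology is then
  \<open>(Z + B) / B\<close>.\<close>

locale linear_cochain_sequence = vector_space "scaling K"
  for K :: "('k::field, 'c::ab_group_add) cochain_complex" +
  assumes subspace_cochains: "subspace (cochains K n)"
    and linear_differential: "Vector_Spaces.linear (scaling K) (scaling K) (differential K n)"
begin

sublocale differential: Vector_Spaces.linear "scaling K" "scaling K" "differential K n" for n
  by (rule linear_differential)

lemma subspace_cocycles: "subspace (cocycles K n)"
  using subspace_cochains[of n]
  by (auto simp: subspace_def cocycles_def differential.add differential.scale)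

lemma subspace_coboundaries: "subspace (coboundaries K n)"
  using differential.subspace_image[OF subspace_cochains]
  by (simp add: coboundaries_def)

lemma coh_class_add: "coh_class K n x + coh_class K n y = coh_class K n (x + y)"
proof -
  have "coboundaries K n + coboundaries K n \<subseteq> coboundaries K n"
    using subspace_add[OF subspace_coboundaries] by (auto simp: set_plus_def)
  moreover have "coboundaries K n \<subseteq> coboundaries K n + coboundaries K n"
    using subspace_0[OF subspace_coboundaries] by (rule set_zero_plus2)
  ultimately have "coboundaries K n + coboundaries K n = coboundaries K n"
    by (rule antisym)
  then show ?thesis
    by (simp add: coh_class_def set_plus_rearrange)
qed

lemma coh_class_eq_iff: "coh_class K n x = coh_class K n y \<longleftrightarrow> x - y \<in> coboundaries K n"
  unfolding coh_class_def
  by (intro coset_eq_iff_diff subspace_0 subspace_diff subspace_coboundaries)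

lemma coh_class_0: "coh_class K n 0 = coboundaries K n"
  by (simp add: coh_class_def)

lemma coh_class_eq_0_iff: "coh_class K n x = coboundaries K n \<longleftrightarrow> x \<in> coboundaries K n"
  using coh_class_eq_iff[of n x 0] by (simp add: coh_class_0)

lemma coh_class_smult: "c \<odot>\<^bsub>cohomology K n\<^esub> coh_class K n x = coh_class K n (scaling K c x)"
proof -
  let ?B = "coboundaries K n"
  note s = subspace_coboundaries[of n, unfolded subspace_def]
  have "scaling K c ` (x +o ?B) + ?B = scaling K c x +o ?B"
  proof (intro equalityI subsetI)
    fix z assume "z \<in> scaling K c ` (x +o ?B) + ?B"
    then obtain b b' where "b \<in> ?B" "b' \<in> ?B" "z = scaling K c (x + b) + b'"
      by (auto simp: elt_set_plus_def set_plus_def)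
    then have "z = scaling K c x + (scaling K c b + b')" "scaling K c b + b' \<in> ?B"
      using s by (auto simp: scale_right_distrib add.assoc)
    then show "z \<in> scaling K c x +o ?B"
      using set_plus_intro2 by blast
  next
    fix z assume "z \<in> scaling K c x +o ?B"
    then obtain b where b: "b \<in> ?B" "z = scaling K c x + b"
      by (auto simp: elt_set_plus_def)
    \<comment> \<open>The representative \<open>x\<close> itself lies in the coset, so
      \<open>b\<close> can be supplied by the second summand. This avoids dividing by
      \<open>c\<close> and covers \<open>c = 0\<close>.\<close>
    moreover have "x \<in> x +o ?B"
      using s set_plus_intro2[of 0 ?B x] by simp
    ultimately show "z \<in> scaling K c ` (x +o ?B) + ?B"
      using set_plus_intro by blast
  qed
  then show ?thesis
    by (simp add: cohomology_def coh_class_def)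
qed

lemma abelian_group_cohomology: "abelian_group (cohomology K n)"
proof (rule abelian_groupI)
  fix X assume "X \<in> carrier (cohomology K n)"
  then obtain x where x: "x \<in> cocycles K n" "X = coh_class K n x"
    by (auto simp: cohomology_def)
  then have "- x \<in> cocycles K n"
    using subspace_neg subspace_cocycles by blast
  moreover have "coh_class K n (- x) + coh_class K n x = coboundaries K n"
    by (simp add: coh_class_add coh_class_0)
  ultimately show "\<exists>Y\<in>carrier (cohomology K n). Y \<oplus>\<^bsub>cohomology K n\<^esub> X = \<zero>\<^bsub>cohomology K n\<^esub>"
    using x by (auto simp: cohomology_def)
next
  show "\<zero>\<^bsub>cohomology K n\<^esub> \<in> carrier (cohomology K n)"
    using subspace_0[OF subspace_cocycles, of n] coh_class_0[of n]
    by (auto simp: cohomology_def)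
next
  fix X Z assume "X \<in> carrier (cohomology K n)" "Z \<in> carrier (cohomology K n)"
  then show "X \<oplus>\<^bsub>cohomology K n\<^esub> Z \<in> carrier (cohomology K n)"
    using subspace_add[OF subspace_cocycles[of n]] by (auto simp: cohomology_def coh_class_add)
next
  fix X assume "X \<in> carrier (cohomology K n)"
  then show "\<zero>\<^bsub>cohomology K n\<^esub> \<oplus>\<^bsub>cohomology K n\<^esub> X = X"
    by (auto simp: cohomology_def coh_class_add simp flip: coh_class_0)
qed (simp_all add: cohomology_def add_ac)

end

text \<open>The image of a coset is in general only part of a coset of the target; adding the
  coboundaries fills it up.\<close>

definition induced_map :: "('k, 'd::ab_group_add) cochain_complex \<Rightarrow> nat \<Rightarrow> ('c \<Rightarrow> 'd) \<Rightarrow> 'c set \<Rightarrow> 'd set"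
  where "induced_map L m \<phi> X = \<phi> ` X + coboundaries L m"

text \<open>One pair of degrees at a time, and no commutation with differentials: \<open>h_P\<close>
  only anticommutes, and the inclusion of the operator complex shifts the degree and is replaced by
  zero in degree 1. Preserving cocycles and coboundaries in the given degrees is what all three maps
  have in common.\<close>

locale induces_cohomology_map =
  K: linear_cochain_sequence K + L: linear_cochain_sequence L +
  map: Vector_Spaces.linear "scaling K" "scaling L" \<phi>
  for K :: "('k::field, 'c::ab_group_add) cochain_complex"
    and L :: "('k, 'd::ab_group_add) cochain_complex"
    and \<phi> :: "'c \<Rightarrow> 'd" and n m :: nat +
  assumes cocycle: "z \<in> cocycles K n \<Longrightarrow> \<phi> z \<in> cocycles L m"
    and coboundary: "z \<in> coboundaries K n \<Longrightarrow> \<phi> z \<in> coboundaries L m"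
begin

lemma induced_map_coh_class [simp]: "induced_map L m \<phi> (coh_class K n z) = coh_class L m (\<phi> z)"
proof -
  have "\<phi> ` coh_class K n z + coboundaries L m = \<phi> z +o (\<phi> ` coboundaries K n + coboundaries L m)"
  proof -
    have "\<phi> ` coh_class K n z = \<phi> z +o \<phi> ` coboundaries K n"
      by (simp add: coh_class_def elt_set_plus_image image_image map.add)
    then show ?thesis
      by (simp add: set_plus_rearrange3)
  qed
  also have "\<phi> ` coboundaries K n + coboundaries L m = coboundaries L m"
  proof (rule antisym)
    show "\<phi> ` coboundaries K n + coboundaries L m \<subseteq> coboundaries L m"
      using coboundary L.subspace_add[OF L.subspace_coboundaries] by (auto simp: set_plus_def)
  next
    have "0 \<in> \<phi> ` coboundaries K n"
      using K.subspace_0[OF K.subspace_coboundaries] map.zero by (metis image_eqI)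
    then show "coboundaries L m \<subseteq> \<phi> ` coboundaries K n + coboundaries L m"
      by (rule set_zero_plus2)
  qed
  finally show ?thesis
    by (simp add: induced_map_def coh_class_def)
qed

lemma linear_map_induced_map:
  "linear_map (cohomology K n) (cohomology L m) (induced_map L m \<phi>)"
  unfolding linear_map_def
proof (intro conjI allI ballI)
  show "abelian_group_hom (cohomology K n) (cohomology L m) (induced_map L m \<phi>)"
  proof (intro abelian_group_homI K.abelian_group_cohomology L.abelian_group_cohomology)
    show "group_hom (add_monoid (cohomology K n)) (add_monoid (cohomology L m)) (induced_map L m \<phi>)"
      using abelian_group.a_group[OF K.abelian_group_cohomology[of n]]
        abelian_group.a_group[OF L.abelian_group_cohomology[of m]]
      unfolding group_hom_def group_hom_axioms_def
      by (auto simp: hom_def cohomology_def K.coh_class_add L.coh_class_add map.add intro: cocycle)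
  qed
next
  fix c X assume "X \<in> carrier (cohomology K n)"
  then obtain x where "X = coh_class K n x"
    by (auto simp: cohomology_def)
  then show "induced_map L m \<phi> (c \<odot>\<^bsub>cohomology K n\<^esub> X) =
      c \<odot>\<^bsub>cohomology L m\<^esub> induced_map L m \<phi> X"
    by (simp add: K.coh_class_smult L.coh_class_smult map.scale)
qed

end

text \<open>Two classes agree iff their representatives differ by a coboundary, so kernel and image
  can be compared on cocycles. The vanishing of the composite is already contained in
  \<open>exact\<close>, read from right to left.\<close>

lemma exact_at_induced_map:
  assumes "induces_cohomology_map K L \<phi> n m" "induces_cohomology_map L N \<psi> m l"
    and exact: "\<And>z. z \<in> cocycles L m \<Longrightarrow>
      \<psi> z \<in> coboundaries N l \<longleftrightarrow> (\<exists>x\<in>cocycles K n. z - \<phi> x \<in> coboundaries L m)"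
  shows "exact_at (cohomology K n) (induced_map L m \<phi>) (cohomology L m) (induced_map N l \<psi>)
    (cohomology N l)"
proof -
  interpret f: induces_cohomology_map K L \<phi> n m by fact
  interpret g: induces_cohomology_map L N \<psi> m l by fact
  have image: "induced_map L m \<phi> ` carrier (cohomology K n) = (\<lambda>x. coh_class L m (\<phi> x)) ` cocycles K n"
    by (simp add: cohomology_def image_image)
  have kernel: "a_kernel (cohomology L m) (cohomology N l) (induced_map N l \<psi>) =
      coh_class L m ` {z \<in> cocycles L m. \<psi> z \<in> coboundaries N l}"
    by (simp add: a_kernel_def' cohomology_def Compr_image_eq g.L.coh_class_eq_0_iff)
  have "coh_class L m ` {z \<in> cocycles L m. \<psi> z \<in> coboundaries N l} =
      (\<lambda>x. coh_class L m (\<phi> x)) ` cocycles K n"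
  proof (intro equalityI subsetI)
    fix Z assume "Z \<in> coh_class L m ` {z \<in> cocycles L m. \<psi> z \<in> coboundaries N l}"
    then show "Z \<in> (\<lambda>x. coh_class L m (\<phi> x)) ` cocycles K n"
      using exact by (auto simp: f.L.coh_class_eq_iff image_iff)
  next
    fix Z assume "Z \<in> (\<lambda>x. coh_class L m (\<phi> x)) ` cocycles K n"
    then obtain x where x: "x \<in> cocycles K n" "Z = coh_class L m (\<phi> x)"
      by blast
    \<comment> \<open>This feeds \<open>exact\<close> with \<open>z = \<phi> x\<close> and the
      witness \<open>x\<close>, giving
      \<open>\<psi> (\<phi> x) \<in> coboundaries N l\<close>.\<close>
    moreover have "\<phi> x - \<phi> x \<in> coboundaries L m"
      using f.L.subspace_0[OF f.L.subspace_coboundaries] by simp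
    ultimately show "Z \<in> coh_class L m ` {z \<in> cocycles L m. \<psi> z \<in> coboundaries N l}"
      using exact f.cocycle by blast
  qed
  then show ?thesis
    unfolding exact_at_def image kernel by simp
qed

section \<open>Compatibility of \<open>h_P\<close> with the differentials\<close>

lemma vertices_eq_0_iff [simp]: "vertices y = 0 \<longleftrightarrow> y = Leaf"
  by (cases y) auto

lemma vertices_pos_iff: "0 < vertices y \<longleftrightarrow> y \<noteq> Leaf"
  by (cases y) auto

lemma vertices_del_leaf: "y \<noteq> Leaf \<Longrightarrow> vertices (del_leaf i y) = vertices y - 1"
proof (induction i y rule: del_leaf.induct)
  case (2 i l r)
  have "vertices l \<ge> 1" if "l \<noteq> Leaf"
    using that vertices_eq_0_iff[of l] by linarith
  moreover have "vertices r \<ge> 1" if "r \<noteq> Leaf"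
    using that vertices_eq_0_iff[of r] by linarith
  ultimately show ?case
    using 2 by auto
qed simp

lemma is_left_leaf_first: "y \<noteq> Leaf \<Longrightarrow> is_left_leaf 0 y"
  by (induction y) auto

lemma not_is_left_leaf_last: "\<not> is_left_leaf (vertices y) y"
  by (induction y) auto

lemma star_first: "star 0 (Node l r) = (if l = Leaf then Dashv else Vdash)"
  by (simp add: star_def)

lemma star_last:
  "star (vertices (Node l r)) (Node l r) = (if r = Leaf then Vdash else Dashv)"
  by (simp add: star_def)

text \<open>The last leaf of a nontrivial left subtree is a right child, and
  \<open>l \<noteq> Leaf\<close> keeps its number away from 0, so the orientation clause of
  \<open>star\<close> decides.\<close>

lemma star_left_of_root:
  "l \<noteq> Leaf \<Longrightarrow> star (vertices l) (Node l r) = Vdash"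
  by (simp add: star_def not_is_left_leaf_last)

lemma star_right_of_root:
  "r \<noteq> Leaf \<Longrightarrow> star (Suc (vertices l)) (Node l r) = Dashv"
  by (simp add: star_def is_left_leaf_first)

text \<open>The argument of \<open>g\<close> in \<open>h_P\<close>. With
  \<open>k = vertices l\<close> the letter from \<open>M\<close> sits at the position of the root of
  \<open>Node l r\<close> in the left-to-right order of the vertices.\<close>

definition root_word :: "('m \<Rightarrow> 'a) \<Rightarrow> nat \<Rightarrow> 'm list \<Rightarrow> ('a + 'm) list" where
  "root_word P k us = (map (\<lambda>u. Inl (P u)) us)[k := Inr (us ! k)]"

lemma length_root_word [simp]: "length (root_word P k us) = length us"
  by (simp add: root_word_def)

lemma nth_root_word:
  "i < length us \<Longrightarrow> root_word P k us ! i = (if i = k then Inr (us ! k) else Inl (P (us ! i)))"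
  by (simp add: root_word_def nth_list_update)

lemma root_word_in_mixed_words:
  assumes "k < length us" "length us = n"
  shows "root_word P k us \<in> mixed_words n"
proof -
  have "root_word P k us =
      map (\<lambda>u. Inl (P u)) (take k us) @ Inr (us ! k) # map (\<lambda>u. Inl (P u)) (drop (Suc k) us)"
    using assms by (simp add: root_word_def upd_conv_take_nth_drop take_map drop_map)
  then show ?thesis
    using assms by (simp add: mixed_words_def filter_map o_def filter_empty_conv)
qed

lemma apply_sum_root_word:
  assumes "k < length us"
  shows "apply_sum f g (root_word P k us) = Inr (g (root_word P k us))"
proof -
  have "root_word P k us ! k \<in> set (root_word P k us)"
    using assms by (intro nth_mem) simp
  moreover have "\<not> isl (root_word P k us ! k)"
    using assms by (simp add: nth_root_word)
  ultimately have "\<not> (\<forall>x\<in>set (root_word P k us). isl x)"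
    by blast
  then show ?thesis
    unfolding apply_sum_def by auto
qed

lemma apply_sum_map_Inl: "apply_sum f g (map (\<lambda>u. Inl (P u)) us) = Inl (f (map P us))"
  by (simp add: apply_sum_def o_def)

text \<open>Merging the entries \<open>j - 1\<close> and \<open>j\<close> produces the new entry
  \<open>j - 1\<close>. If \<open>j \<le> k\<close>, the marked position moves down to
  \<open>k - 1\<close>, which is the merged entry exactly for \<open>j = k\<close>. In the companion
  lemma with \<open>k < j\<close> the mark stays at \<open>k\<close>, and the merged entry carries
  it exactly for \<open>j = Suc k\<close>.\<close>

lemma root_word_merge_left:
  assumes "1 \<le> j" "j \<le> k" "k < length us"
  shows "root_word P (k - 1) (take (j - 1) us @ [m] @ drop (j + 1) us) =
    take (j - 1) (root_word P k us) @ [if j = k then Inr m else Inl (P m)] @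
    drop (j + 1) (root_word P k us)"
  using assms by (intro nth_equalityI) (auto simp: nth_root_word nth_append nth_Cons')

lemma root_word_merge_right:
  assumes "k < j" "j < length us"
  shows "root_word P k (take (j - 1) us @ [m] @ drop (j + 1) us) =
    take (j - 1) (root_word P k us) @ [if j = Suc k then Inr m else Inl (P m)] @
    drop (j + 1) (root_word P k us)"
  using assms by (intro nth_equalityI) (auto simp: nth_root_word nth_append nth_Cons')

lemma root_word_drop: "0 < k \<Longrightarrow> k < length us \<Longrightarrow>
    drop 1 (root_word P k us) = root_word P (k - 1) (drop 1 us)"
  by (intro nth_equalityI) (auto simp: nth_root_word)

lemma root_word_drop_0: "drop 1 (root_word P 0 us) = map (\<lambda>u. Inl (P u)) (drop 1 us)"
  by (intro nth_equalityI) (auto simp: nth_root_word)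

lemma root_word_take: "k < n \<Longrightarrow> n \<le> length us \<Longrightarrow>
    take n (root_word P k us) = root_word P k (take n us)"
  by (intro nth_equalityI) (auto simp: nth_root_word)

lemma root_word_take_last: "take k (root_word P k us) = map (\<lambda>u. Inl (P u)) (take k us)"
  by (intro nth_equalityI) (auto simp: nth_root_word)

lemma h_P_Node:
  assumes "vertices l + vertices r + 1 = n" "length us = n"
  shows "h_P scaleA P n f g (Node l r) us =
    scaleA ((-1) ^ n) (f (map P us) - P (g (root_word P (vertices l) us)))"
  using assms by (simp add: h_P_def Y_def root_word_def)

section \<open>Comparison of the summands of \<open>delta_P\<close> on \<open>h_P f g\<close> with
  those of the Hochschild differentials\<close>

context relative_averaging_algebra
begin

sublocale P: Vector_Spaces.linear scaleM scaleA P
  by (rule P_linear)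

sublocale lact_alg: Vector_Spaces.linear scaleA scaleM "\<lambda>a. lact a u" for u
  by (rule lact_linear_alg)

sublocale lact_mod: Vector_Spaces.linear scaleM scaleM "lact a" for a
  by (rule lact_linear_mod)

sublocale ract_mod: Vector_Spaces.linear scaleM scaleM "\<lambda>u. ract u a" for a
  by (rule ract_linear_mod)

sublocale ract_alg: Vector_Spaces.linear scaleA scaleM "\<lambda>a. ract u a" for u
  by (rule ract_linear_alg)

text \<open>Both operations become the product of \<open>A\<close> after applying \<open>P\<close>.
  Hence the choice made by \<open>star\<close> matters only where a merged entry is not hit by
  \<open>P\<close>, that is, at the marked letter.\<close>

lemma P_diass_P: "P (diass_P lact ract P d u v) = P u * P v"
  by (cases d) (simp_all add: averaging_left[symmetric] averaging_right[symmetric])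

lemma linear_diass_left: "Vector_Spaces.linear scaleA scaleA (diass_left ract P d u)"
  by (cases d; unfold_locales)
    (simp_all add: ract_alg.add ract_alg.scale P.add P.scale distrib_left
      scale_mult_right A.scale_right_diff_distrib)

lemma linear_diass_right: "Vector_Spaces.linear scaleA scaleA (\<lambda>a. diass_right lact P d a u)"
  by (cases d; unfold_locales)
    (simp_all add: lact_alg.add lact_alg.scale P.add P.scale distrib_right
      scale_mult_left A.scale_right_diff_distrib)

text \<open>The shape of a differential with its outer terms separated: the sign \<open>c\<close> of
  \<open>h_P\<close> and the operator \<open>P\<close> are pulled out of all summands at
  once.\<close>

lemma alternating_sum:
  "scaleA c (a0 - P b0) + (\<Sum>i\<in>I. scaleA (e i) (scaleA c (a i - P (b i)))) +
      scaleA e' (scaleA c (a' - P b')) =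
    scaleA c ((a0 + (\<Sum>i\<in>I. scaleA (e i) (a i)) + scaleA e' a') -
      P (b0 + (\<Sum>i\<in>I. scaleM (e i) (b i)) + scaleM e' b'))"
  by (simp add: P.add P.sum P.scale A.scale_right_distrib A.scale_right_diff_distrib
      A.scale_sum_right sum_subtractf mult.commute)

context
  fixes n :: nat and l r :: pbtree and us :: "'m list"
  assumes n: "n \<ge> 1" and y: "vertices (Node l r) = n + 1" and us: "length us = n + 1"
begin

text \<open>If \<open>l = Leaf\<close>, dropping the first entry removes the marked letter, so on
  the right \<open>apply_sum\<close> selects \<open>f\<close>. The action on the left is
  \<open>Dashv\<close>: its correction \<open>- P (ract u a)\<close> on the \<open>f\<close> part of
  the cochain is the required module term, and on the \<open>P g\<close> part it cancels the product
  by \<open>averaging_right\<close>. If \<open>l \<noteq> Leaf\<close>, the mark survives, the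
  action is plain multiplication, and \<open>averaging_left\<close> moves \<open>P\<close>
  outside.\<close>

lemma h_P_first:
  "diass_left ract P (star 0 (Node l r)) (us ! 0)
      (h_P scaleA P n f g (del_leaf 0 (Node l r)) (drop 1 us)) =
    scaleA ((-1) ^ n) (P (us ! 0) * f (map P (drop 1 us)) - P (projr (letter_mult lact ract
      (root_word P (vertices l) us ! 0) (apply_sum f g (drop 1 (root_word P (vertices l) us))))))"
proof (cases "l = Leaf")
  case True
  with n y obtain l' r' where r: "r = Node l' r'"
    by (cases r) auto
  interpret dl: Vector_Spaces.linear scaleA scaleA "diass_left ract P Dashv (us ! 0)"
    by (rule linear_diass_left)
  have "root_word P 0 us ! 0 = Inr (us ! 0)"
    using us by (subst nth_root_word) auto
  moreover have "h_P scaleA P n f g r (drop 1 us) =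
      scaleA ((-1) ^ n) (f (map P (drop 1 us)) - P (g (root_word P (vertices l') (drop 1 us))))"
    using True y us unfolding r by (subst h_P_Node) auto
  ultimately show ?thesis
    using True
    by (simp add: star_first root_word_drop_0[unfolded One_nat_def] apply_sum_map_Inl dl.scale
        del: diass_left.simps)
      (simp add: ract_alg.diff P.diff averaging_right algebra_simps)
next
  case False
  interpret dl: Vector_Spaces.linear scaleA scaleA "diass_left ract P Vdash (us ! 0)"
    by (rule linear_diass_left)
  have k: "0 < vertices l" "vertices l < length us"
    using False y us by (auto simp: vertices_pos_iff)
  have "root_word P (vertices l) us ! 0 = Inl (P (us ! 0))"
    using us k by (subst nth_root_word) auto
  moreover have "h_P scaleA P n f g (Node (del_leaf 0 l) r) (drop 1 us) =
      scaleA ((-1) ^ n) (f (map P (drop 1 us)) - P (g (root_word P (vertices l - 1) (drop 1 us))))"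
    using k False y us by (subst h_P_Node) (auto simp: vertices_del_leaf)
  moreover have "apply_sum f g (drop 1 (root_word P (vertices l) us)) =
      Inr (g (root_word P (vertices l - 1) (drop 1 us)))"
    using k by (simp only: root_word_drop) (rule apply_sum_root_word, auto)
  ultimately show ?thesis
    using False by (simp add: star_first dl.scale del: diass_left.simps)
      (simp add: averaging_left[symmetric] algebra_simps)
qed

text \<open>Mirror image of \<open>h_P_first\<close>: now \<open>r = Leaf\<close> is the case where
  the marked letter is cut off, and the two averaging identities exchange roles.\<close>

lemma h_P_last:
  "diass_right lact P (star (n + 1) (Node l r))
      (h_P scaleA P n f g (del_leaf (n + 1) (Node l r)) (take n us)) (us ! n) =
    scaleA ((-1) ^ n) (f (map P (take n us)) * P (us ! n) - P (projr (letter_mult lact ract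
      (apply_sum f g (take n (root_word P (vertices l) us))) (root_word P (vertices l) us ! n))))"
proof (cases "r = Leaf")
  case True
  with n y obtain l' r' where l: "l = Node l' r'"
    by (cases l) auto
  interpret dr: Vector_Spaces.linear scaleA scaleA "\<lambda>a. diass_right lact P Vdash a (us ! n)"
    by (rule linear_diass_right)
  have k: "vertices l = n"
    using y True by simp
  have "star (n + 1) (Node l r) = Vdash"
    using star_last[of l r] True y by simp
  moreover have "root_word P n us ! n = Inr (us ! n)"
    using us by (subst nth_root_word) auto
  moreover have "del_leaf (n + 1) (Node l r) = l"
    using k True by simp
  moreover have "h_P scaleA P n f g l (take n us) =
      scaleA ((-1) ^ n) (f (map P (take n us)) - P (g (root_word P (vertices l') (take n us))))"
    using k us unfolding l by (subst h_P_Node) auto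
  ultimately show ?thesis
    by (simp add: k root_word_take_last apply_sum_map_Inl dr.scale
        del: diass_right.simps del_leaf.simps)
      (simp add: lact_alg.diff P.diff averaging_left algebra_simps)
next
  case False
  interpret dr: Vector_Spaces.linear scaleA scaleA "\<lambda>a. diass_right lact P Dashv a (us ! n)"
    by (rule linear_diass_right)
  have r: "0 < vertices r"
    using False by (simp add: vertices_pos_iff)
  with y have k: "vertices l < n"
    by simp
  have "star (n + 1) (Node l r) = Dashv"
    using star_last[of l r] False y by simp
  moreover have "root_word P (vertices l) us ! n = Inl (P (us ! n))"
    using us k by (subst nth_root_word) auto
  moreover have "h_P scaleA P n f g (del_leaf (n + 1) (Node l r)) (take n us) =
      scaleA ((-1) ^ n) (f (map P (take n us)) - P (g (root_word P (vertices l) (take n us))))"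
    using k r False y us by (simp, subst h_P_Node) (auto simp: vertices_del_leaf)
  ultimately show ?thesis
    using k us
    by (simp add: root_word_take apply_sum_root_word dr.scale
        del: diass_right.simps del_leaf.simps)
      (simp add: averaging_right[symmetric] algebra_simps)
qed

text \<open>Deleting an inner leaf merges two neighbouring entries and keeps the root. The marked
  letter is involved only for \<open>j = vertices l\<close>, where \<open>Vdash\<close> lets the
  left neighbour act on it, and for \<open>j = Suc (vertices l)\<close>, where \<open>Dashv\<close>
  lets the right neighbour act; these are the values that \<open>letter_mult\<close> prescribes. All
  other merges are products of values of \<open>P\<close>.\<close>

lemma h_P_middle:
  assumes j: "1 \<le> j" "j \<le> n"
  shows "h_P scaleA P n f g (del_leaf j (Node l r)) (take (j - 1) us @
      [diass_P lact ract P (star j (Node l r)) (us ! (j - 1)) (us ! j)] @ drop (j + 1) us) =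
    scaleA ((-1) ^ n) (f (take (j - 1) (map P us) @ [map P us ! (j - 1) * map P us ! j] @
        drop (j + 1) (map P us)) -
      P (g (take (j - 1) (root_word P (vertices l) us) @
        [letter_mult lact ract (root_word P (vertices l) us ! (j - 1)) (root_word P (vertices l) us ! j)] @
        drop (j + 1) (root_word P (vertices l) us))))"
    (is "h_P scaleA P n f g _ (_ @ [?m] @ _) = scaleA _ (?F - P (g (_ @ [?letter] @ _)))")
proof -
  have F: "f (map P (take (j - 1) us @ [?m] @ drop (j + 1) us)) = ?F"
    using j us by (simp add: take_map drop_map P_diass_P)
  show ?thesis
  proof (cases "j \<le> vertices l")
    case True
    then have l: "l \<noteq> Leaf" "vertices l < length us"
      using j y us by auto
    have "?letter = (if j = vertices l then Inr ?m else Inl (P ?m))"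
      using j us l True star_left_of_root[of l r] by (auto simp: nth_root_word P_diass_P)
    then have w: "root_word P (vertices l - 1) (take (j - 1) us @ [?m] @ drop (j + 1) us) =
        take (j - 1) (root_word P (vertices l) us) @ [?letter] @ drop (j + 1) (root_word P (vertices l) us)"
      using root_word_merge_left[OF j(1) True l(2), of P ?m] by simp
    have "del_leaf j (Node l r) = Node (del_leaf j l) r"
      using True l by simp
    moreover have "vertices (del_leaf j l) = vertices l - 1" "0 < vertices l"
      using vertices_del_leaf l(1) by (auto simp: vertices_pos_iff)
    ultimately show ?thesis
      using y us j by (simp only:, subst h_P_Node, auto simp only: F w) auto
  next
    case False
    \<comment> \<open>If \<open>r\<close> were a leaf, then \<open>vertices l = n\<close>, and
      \<open>j \<le> n\<close> would belong to the first case.\<close>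
    then have r: "r \<noteq> Leaf" "vertices l < j" "j < length us"
      using j y us by auto
    have "?letter = (if j = Suc (vertices l) then Inr ?m else Inl (P ?m))"
      using j us r star_right_of_root[of r l] by (auto simp: nth_root_word P_diass_P)
    then have w: "root_word P (vertices l) (take (j - 1) us @ [?m] @ drop (j + 1) us) =
        take (j - 1) (root_word P (vertices l) us) @ [?letter] @ drop (j + 1) (root_word P (vertices l) us)"
      using root_word_merge_right[OF r(2,3), of P ?m] by simp
    have "del_leaf j (Node l r) = Node l (del_leaf (j - vertices l - 1) r)"
      using False r by simp
    moreover have "vertices (del_leaf (j - vertices l - 1) r) = vertices r - 1" "0 < vertices r"
      using vertices_del_leaf r(1) by (auto simp: vertices_pos_iff)
    ultimately show ?thesis
      using y us j by (simp only:, subst h_P_Node, auto simp only: F w) auto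
  qed
qed

text \<open>The unsigned expressions agree; the minus sign is the quotient of the signs
  \<open>(-1) ^ n\<close> and \<open>(-1) ^ (n + 1)\<close> that \<open>h_P\<close> carries in
  consecutive degrees.\<close>

lemma delta_P_h_P_Node:
  "delta_P scaleA lact ract P n (h_P scaleA P n f g) (Node l r) us =
    - h_P scaleA P (n + 1) (delta_Hoch scaleA n f) (delta_Hoch_rel scaleM lact ract n f g) (Node l r) us"
proof -
  let ?w = "root_word P (vertices l) us"
  have w: "?w \<in> mixed_words (n + 1)"
    using y us by (intro root_word_in_mixed_words) auto
  have Y: "Node l r \<in> Y (n + 1)"
    using y by (simp add: Y_def)
  have "delta_P scaleA lact ract P n (h_P scaleA P n f g) (Node l r) us =
      scaleA ((-1) ^ n) (delta_Hoch scaleA n f (map P us) -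
        P (delta_Hoch_rel scaleM lact ract n f g ?w))"
  proof -
    have "delta_P scaleA lact ract P n (h_P scaleA P n f g) (Node l r) us =
        scaleA ((-1) ^ n) (P (us ! 0) * f (map P (drop 1 us)) - P (projr (letter_mult lact ract
            (?w ! 0) (apply_sum f g (drop 1 ?w))))) +
        (\<Sum>i = 1..n. scaleA ((-1) ^ i) (scaleA ((-1) ^ n)
          (f (take (i - 1) (map P us) @ [map P us ! (i - 1) * map P us ! i] @
              drop (i + 1) (map P us)) -
           P (g (take (i - 1) ?w @ [letter_mult lact ract (?w ! (i - 1)) (?w ! i)] @
              drop (i + 1) ?w))))) +
        scaleA ((-1) ^ (n + 1)) (scaleA ((-1) ^ n) (f (map P (take n us)) * P (us ! n) -
          P (projr (letter_mult lact ract (apply_sum f g (take n ?w)) (?w ! n)))))"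
      using Y us unfolding delta_P_def h_P_first h_P_last
      by (simp only: if_True simp_thms)
        (intro arg_cong2[where f = "(+)"] sum.cong refl arg_cong[where f = "scaleA _"]
          h_P_middle, auto)
    then show ?thesis
      using us w n by (simp only: alternating_sum)
        (simp add: delta_Hoch_def delta_Hoch_rel_def drop_map take_map)
  qed
  moreover have "h_P scaleA P (n + 1) (delta_Hoch scaleA n f) (delta_Hoch_rel scaleM lact ract n f g)
      (Node l r) us = scaleA ((-1) ^ (n + 1)) (delta_Hoch scaleA n f (map P us) -
        P (delta_Hoch_rel scaleM lact ract n f g ?w))"
    using y us by (subst h_P_Node) auto
  ultimately show ?thesis
    by simp
qed

end

lemma delta_P_h_P:
  assumes "n \<ge> 1"
  shows "delta_P scaleA lact ract P n (h_P scaleA P n f g) =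
    - h_P scaleA P (n + 1) (delta_Hoch scaleA n f) (delta_Hoch_rel scaleM lact ract n f g)"
proof (intro ext)
  fix y us
  show "delta_P scaleA lact ract P n (h_P scaleA P n f g) y us =
    (- h_P scaleA P (n + 1) (delta_Hoch scaleA n f) (delta_Hoch_rel scaleM lact ract n f g)) y us"
  proof (cases "y \<in> Y (n + 1) \<and> length us = n + 1")
    case True
    then obtain l r where "y = Node l r"
      by (cases y) (auto simp: Y_def)
    then show ?thesis
      using delta_P_h_P_Node[of n l r us f g] True assms by (simp add: Y_def)
  next
    case False
    then show ?thesis
      by (auto simp: delta_P_def h_P_def)
  qed
qed

end

section \<open>Linearity of the differentials\<close>

lemma filter_length_1D: "length (filter Q xs) = Suc 0 \<Longrightarrow> \<exists>x\<in>set xs. Q x"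
  by (rule ccontr) simp

text \<open>Guarantees that exactly one factor of an outer product involves \<open>M\<close>. Then
  \<open>letter_mult\<close> yields an \<open>Inr\<close> value coming from a bimodule action and
  \<open>projr\<close> is meaningful, which the linearity of the outer terms depends on.\<close>

lemma mixed_words_first:
  assumes "w \<in> mixed_words (n + 1)"
  shows "isl (w ! 0) \<longleftrightarrow> \<not> (\<forall>z\<in>set (drop 1 w). isl z)"
  using assms by (cases w) (auto simp: mixed_words_def filter_empty_conv dest: filter_length_1D split: if_splits)

lemma mixed_words_last:
  assumes "w \<in> mixed_words (n + 1)"
  shows "isl (w ! n) \<longleftrightarrow> \<not> (\<forall>z\<in>set (take n w). isl z)"
proof -
  have "w = take n w @ [w ! n]"
    using assms by (simp add: mixed_words_def flip: take_Suc_conv_app_nth)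
  then have "length (filter (\<lambda>x. \<not> isl x) (take n w @ [w ! n])) = 1"
    using assms by (simp add: mixed_words_def)
  then show ?thesis
    by (auto simp: filter_empty_conv dest: filter_length_1D split: if_splits)
qed

context relative_averaging_algebra
begin

abbreviation "KP \<equiv> complex_P scaleA scaleM lact ract P"
abbreviation "KB \<equiv> complex_AssBimod scaleA scaleM lact ract"
abbreviation "KR \<equiv> complex_rAvg scaleA scaleM lact ract P"

lemma complex_P_simps [simp]:
  "cochains KP = CY scaleA scaleM"
  "differential KP = delta_P scaleA lact ract P"
  "scaling KP c \<gamma> = (\<lambda>y us. scaleA c (\<gamma> y us))"
  by (simp_all add: complex_P_def)

lemma complex_AssBimod_simps [simp]:
  "cochains KB = C_AssBimod scaleA scaleM"
  "differential KB n (f, g) = (delta_Hoch scaleA n f, delta_Hoch_rel scaleM lact ract n f g)"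
  "scaling KB c (f, g) = (\<lambda>as. scaleA c (f as), \<lambda>w. scaleM c (g w))"
  by (simp_all add: complex_AssBimod_def)

lemma complex_rAvg_simps [simp]:
  "cochains KR = C_rAvg scaleA scaleM"
  "differential KR n (f, g, \<gamma>) = (delta_Hoch scaleA n f, delta_Hoch_rel scaleM lact ract n f g,
    delta_P scaleA lact ract P (n - 1) \<gamma> + h_P scaleA P n f g)"
  "scaling KR c (f, g, \<gamma>) =
    (\<lambda>as. scaleA c (f as), \<lambda>w. scaleM c (g w), \<lambda>y us. scaleA c (\<gamma> y us))"
  by (simp_all add: complex_rAvg_def)

sublocale diass_left: Vector_Spaces.linear scaleA scaleA "diass_left ract P d u" for d u
  by (rule linear_diass_left)

sublocale diass_right: Vector_Spaces.linear scaleA scaleA "\<lambda>a. diass_right lact P d a u" for d u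
  by (rule linear_diass_right)

text \<open>Here and below, linearity holds on the whole ambient function space: each summand
  evaluates the cochain once and applies linear maps to the value.\<close>

lemma delta_P_add:
  "delta_P scaleA lact ract P n (\<gamma> + \<gamma>') =
    delta_P scaleA lact ract P n \<gamma> + delta_P scaleA lact ract P n \<gamma>'"
  by (intro ext) (simp add: delta_P_def diass_left.add diass_right.add sum.distrib
      A.scale_right_distrib)

lemma delta_P_scale:
  "delta_P scaleA lact ract P n (\<lambda>y us. scaleA c (\<gamma> y us)) =
    (\<lambda>y us. scaleA c (delta_P scaleA lact ract P n \<gamma> y us))"
  by (intro ext) (simp add: delta_P_def diass_left.scale diass_right.scale A.scale_sum_right
      A.scale_right_distrib A.scale_right_diff_distrib mult.commute)

lemma delta_Hoch_add:
  "delta_Hoch scaleA n (f + f') = delta_Hoch scaleA n f + delta_Hoch scaleA n f'"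
  by (intro ext) (simp add: delta_Hoch_def sum.distrib algebra_simps)

lemma delta_Hoch_scale:
  "delta_Hoch scaleA n (\<lambda>as. scaleA c (f as)) = (\<lambda>as. scaleA c (delta_Hoch scaleA n f as))"
  by (intro ext) (simp add: delta_Hoch_def A.scale_sum_right A.scale_right_distrib
      A.scale_right_diff_distrib scale_mult_left scale_mult_right mult.commute)

lemma letter_mult_apply_sum_add:
  assumes "isl x \<longleftrightarrow> \<not> (\<forall>z\<in>set w. isl z)"
  shows "projr (letter_mult lact ract x (apply_sum (f + f') (g + g') w)) =
      projr (letter_mult lact ract x (apply_sum f g w)) +
      projr (letter_mult lact ract x (apply_sum f' g' w))"
    and "projr (letter_mult lact ract (apply_sum (f + f') (g + g') w) x) =
      projr (letter_mult lact ract (apply_sum f g w) x) +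
      projr (letter_mult lact ract (apply_sum f' g' w) x)"
  using assms by (cases x; force simp: apply_sum_def lact_alg.add lact_mod.add ract_alg.add
      ract_mod.add)+

lemma letter_mult_apply_sum_scale:
  assumes "isl x \<longleftrightarrow> \<not> (\<forall>z\<in>set w. isl z)"
  shows "projr (letter_mult lact ract x (apply_sum (\<lambda>as. scaleA c (f as)) (\<lambda>w. scaleM c (g w)) w)) =
      scaleM c (projr (letter_mult lact ract x (apply_sum f g w)))"
    and "projr (letter_mult lact ract (apply_sum (\<lambda>as. scaleA c (f as)) (\<lambda>w. scaleM c (g w)) w) x) =
      scaleM c (projr (letter_mult lact ract (apply_sum f g w) x))"
  using assms by (cases x; force simp: apply_sum_def lact_alg.scale lact_mod.scale ract_alg.scale
      ract_mod.scale)+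

lemma delta_Hoch_rel_add:
  "delta_Hoch_rel scaleM lact ract n (f + f') (g + g') =
    delta_Hoch_rel scaleM lact ract n f g + delta_Hoch_rel scaleM lact ract n f' g'"
  by (intro ext) (simp add: delta_Hoch_rel_def sum.distrib M.scale_right_distrib
      letter_mult_apply_sum_add(1)[OF mixed_words_first]
      letter_mult_apply_sum_add(2)[OF mixed_words_last] del: One_nat_def)

lemma delta_Hoch_rel_scale:
  "delta_Hoch_rel scaleM lact ract n (\<lambda>as. scaleA c (f as)) (\<lambda>w. scaleM c (g w)) =
    (\<lambda>w. scaleM c (delta_Hoch_rel scaleM lact ract n f g w))"
  by (intro ext) (simp add: delta_Hoch_rel_def M.scale_sum_right M.scale_right_distrib mult.commute
      letter_mult_apply_sum_scale(1)[OF mixed_words_first]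
      letter_mult_apply_sum_scale(2)[OF mixed_words_last] del: One_nat_def)

lemma h_P_add: "h_P scaleA P n (f + f') (g + g') = h_P scaleA P n f g + h_P scaleA P n f' g'"
  by (intro ext) (simp add: h_P_def P.add A.scale_right_distrib A.scale_right_diff_distrib
      split: pbtree.split)

lemma h_P_scale:
  "h_P scaleA P n (\<lambda>as. scaleA c (f as)) (\<lambda>w. scaleM c (g w)) =
    (\<lambda>y us. scaleA c (h_P scaleA P n f g y us))"
  by (intro ext) (simp add: h_P_def P.scale A.scale_right_diff_distrib mult.commute
      split: pbtree.split)

lemma vector_space_scaling_P: "vector_space (scaling KP)"
  by unfold_locales (auto simp: fun_eq_iff A.scale_right_distrib A.scale_left_distrib)

lemma vector_space_scaling_AssBimod: "vector_space (scaling KB)"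
  by unfold_locales (auto simp: fun_eq_iff A.scale_right_distrib A.scale_left_distrib
      M.scale_right_distrib M.scale_left_distrib)

lemma vector_space_scaling_rAvg: "vector_space (scaling KR)"
  by unfold_locales (auto simp: fun_eq_iff A.scale_right_distrib A.scale_left_distrib
      M.scale_right_distrib M.scale_left_distrib)

section \<open>Cochain spaces as subspaces, and the values of \<open>h_P\<close> as cochains\<close>

lemma subspace_multilinear:
  assumes "vector_space s" "vector_space t"
  shows "module.subspace (\<lambda>c f xs. t c (f xs)) {f. multilinear s t n f}"
proof -
  interpret t: vector_space t by fact
  interpret f: vector_space "\<lambda>c f xs. t c (f xs)"
    by unfold_locales (auto simp: fun_eq_iff t.scale_right_distrib t.scale_left_distrib)
  show ?thesis
    using assms by (intro f.subspaceI)
      (auto simp: multilinear_def Vector_Spaces.linear_iff t.scale_right_distrib mult.commute)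
qed

text \<open>Linearity in each letter is spelled out as equations, with the vector space conditions
  discharged once, so that closure under sums and scalars becomes equational.\<close>

lemma mixed_multilinear_iff:
  "mixed_multilinear scaleA scaleM n g \<longleftrightarrow>
    (\<forall>w. w \<notin> mixed_words n \<longrightarrow> g w = 0) \<and>
    (\<forall>w\<in>mixed_words n. \<forall>i<n. isl (w ! i) \<longrightarrow>
      (\<forall>a b. g (w[i := Inl (a + b)]) = g (w[i := Inl a]) + g (w[i := Inl b]))) \<and>
    (\<forall>w\<in>mixed_words n. \<forall>i<n. isl (w ! i) \<longrightarrow>
      (\<forall>c a. g (w[i := Inl (scaleA c a)]) = scaleM c (g (w[i := Inl a])))) \<and>
    (\<forall>w\<in>mixed_words n. \<forall>i<n. \<not> isl (w ! i) \<longrightarrow>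
      (\<forall>u v. g (w[i := Inr (u + v)]) = g (w[i := Inr u]) + g (w[i := Inr v]))) \<and>
    (\<forall>w\<in>mixed_words n. \<forall>i<n. \<not> isl (w ! i) \<longrightarrow>
      (\<forall>c u. g (w[i := Inr (scaleM c u)]) = scaleM c (g (w[i := Inr u]))))"
  unfolding mixed_multilinear_def Vector_Spaces.linear_iff
  using A.vector_space_axioms M.vector_space_axioms by (auto split: if_splits)

lemma subspace_mixed_multilinear:
  "module.subspace (\<lambda>c g w. scaleM c (g w)) {g. mixed_multilinear scaleA scaleM n g}"
proof -
  interpret f: vector_space "\<lambda>c g w. scaleM c (g w)"
    by unfold_locales (auto simp: fun_eq_iff M.scale_right_distrib M.scale_left_distrib)
  show ?thesis
    by (intro f.subspaceI)
      (auto simp: mixed_multilinear_iff M.scale_right_distrib mult.commute)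
qed

lemma subspace_CY: "module.subspace (scaling KP) (CY scaleA scaleM n)"
proof -
  interpret P: vector_space "scaling KP"
    by (rule vector_space_scaling_P)
  interpret f: vector_space "\<lambda>c f xs. scaleA c (f xs)"
    by unfold_locales (auto simp: fun_eq_iff A.scale_right_distrib A.scale_left_distrib)
  note s = subspace_multilinear[OF M.vector_space_axioms A.vector_space_axioms,
      unfolded f.subspace_def, simplified]
  show ?thesis
    using s by (intro P.subspaceI) (auto simp: CY_def fun_eq_iff)
qed

lemma subspace_C_AssBimod: "module.subspace (scaling KB) (C_AssBimod scaleA scaleM n)"
proof -
  interpret B: vector_space "scaling KB"
    by (rule vector_space_scaling_AssBimod)
  interpret f: vector_space "\<lambda>c f xs. scaleA c (f xs)"
    by unfold_locales (auto simp: fun_eq_iff A.scale_right_distrib A.scale_left_distrib)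
  interpret g: vector_space "\<lambda>c g w. scaleM c (g w)"
    by unfold_locales (auto simp: fun_eq_iff M.scale_right_distrib M.scale_left_distrib)
  note s = subspace_multilinear[OF A.vector_space_axioms A.vector_space_axioms,
      unfolded f.subspace_def, simplified]
    subspace_mixed_multilinear[unfolded g.subspace_def, simplified]
  show ?thesis
    using s by (intro B.subspaceI) (auto simp: C_AssBimod_def zero_prod_def fun_eq_iff)
qed

text \<open>Degrees 0 and 1 share the clause \<open>\<gamma> = 0\<close>; in degree 0 the
  associative part is zero as well. The subspace property then reduces to the other two
  complexes.\<close>

lemma C_rAvg_eq:
  "C_rAvg scaleA scaleM n = {(f, g, \<gamma>). (f, g) \<in> C_AssBimod scaleA scaleM n \<and>
    (if n \<le> 1 then \<gamma> = 0 else \<gamma> \<in> CY scaleA scaleM (n - 1))}"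
  by (auto simp: C_rAvg_def C_AssBimod_def zero_prod_def)

lemma subspace_C_rAvg: "module.subspace (scaling KR) (C_rAvg scaleA scaleM n)"
proof -
  interpret P: vector_space "scaling KP"
    by (rule vector_space_scaling_P)
  interpret B: vector_space "scaling KB"
    by (rule vector_space_scaling_AssBimod)
  interpret R: vector_space "scaling KR"
    by (rule vector_space_scaling_rAvg)
  show ?thesis
    using P.subspace_0[OF subspace_CY] P.subspace_add[OF subspace_CY]
      P.subspace_scale[OF subspace_CY] B.subspace_0[OF subspace_C_AssBimod]
      B.subspace_add[OF subspace_C_AssBimod, of "(f, g)" n "(f', g')" for f g f' g']
      B.subspace_scale[OF subspace_C_AssBimod, of "(f, g)" for f g]
    by (intro R.subspaceI) (auto simp: C_rAvg_eq zero_prod_def simp flip: zero_fun_def)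
qed

lemma linear_cochain_sequence_P: "linear_cochain_sequence KP"
  using vector_space_scaling_P subspace_CY
  by (auto simp: linear_cochain_sequence_def linear_cochain_sequence_axioms_def
      Vector_Spaces.linear_iff delta_P_add delta_P_scale)

lemma linear_cochain_sequence_AssBimod: "linear_cochain_sequence KB"
  using vector_space_scaling_AssBimod subspace_C_AssBimod
  by (auto simp: linear_cochain_sequence_def linear_cochain_sequence_axioms_def
      Vector_Spaces.linear_iff delta_Hoch_add delta_Hoch_scale delta_Hoch_rel_add
      delta_Hoch_rel_scale)

lemma linear_cochain_sequence_rAvg: "linear_cochain_sequence KR"
  using vector_space_scaling_rAvg subspace_C_rAvg
  by (auto simp: linear_cochain_sequence_def linear_cochain_sequence_axioms_def
      Vector_Spaces.linear_iff delta_Hoch_add delta_Hoch_scale delta_Hoch_rel_add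
      delta_Hoch_rel_scale delta_P_add delta_P_scale h_P_add h_P_scale fun_eq_iff
      A.scale_right_distrib)

lemma root_word_update:
  "i < length us \<Longrightarrow> root_word P k (us[i := u]) =
    (root_word P k us)[i := (if i = k then Inr u else Inl (P u))]"
  by (intro nth_equalityI) (auto simp: nth_root_word nth_list_update)

text \<open>Varying one entry of \<open>us\<close> varies one letter of the root word, directly at
  the marked position and through the linear map \<open>P\<close> elsewhere.\<close>

lemma h_P_in_CY:
  assumes "n \<ge> 1" "(f, g) \<in> C_AssBimod scaleA scaleM n"
  shows "h_P scaleA P n f g \<in> CY scaleA scaleM n"
proof -
  have f: "multilinear scaleA scaleA n f" and g: "mixed_multilinear scaleA scaleM n g"
    using assms by (auto simp: C_AssBimod_def)
  have "multilinear scaleM scaleA n (h_P scaleA P n f g y)" if y: "y \<in> Y n" for y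
  proof -
    obtain l r where lr: "y = Node l r" "vertices l + vertices r + 1 = n"
      using y assms(1) by (cases y) (auto simp: Y_def)
    have "Vector_Spaces.linear scaleM scaleA (\<lambda>u. h_P scaleA P n f g y (us[i := u]))"
      if us: "length us = n" and i: "i < n" for us i
    proof -
      have "root_word P (vertices l) us \<in> mixed_words n"
        using lr us by (intro root_word_in_mixed_words) auto
      with g us i lr have "if i = vertices l
          then Vector_Spaces.linear scaleM scaleM (\<lambda>u. g ((root_word P (vertices l) us)[i := Inr u]))
          else Vector_Spaces.linear scaleA scaleM (\<lambda>a. g ((root_word P (vertices l) us)[i := Inl a]))"
        unfolding mixed_multilinear_def by (auto simp: nth_root_word dest!: bspec spec[of _ i])
      moreover have "Vector_Spaces.linear scaleA scaleA (\<lambda>a. f ((map P us)[i := a]))"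
        using f us i by (auto simp: multilinear_def)
      ultimately show ?thesis
        using lr us i
        by (auto simp: h_P_Node root_word_update map_update Vector_Spaces.linear_iff P.add P.scale
            A.scale_right_distrib A.scale_right_diff_distrib mult.commute split: if_splits)
    qed
    then show ?thesis
      by (auto simp: multilinear_def h_P_def)
  qed
  then show ?thesis
    by (auto simp: CY_def h_P_def fun_eq_iff)
qed

text \<open>The negative of the Hochschild coboundary that \<open>a\<close> would have as a cochain
  of degree 0. The sign is chosen to match the factor \<open>-1\<close> of \<open>h_P\<close> in
  degree 1.\<close>

definition inner_derivation :: "'a \<Rightarrow> ('a list \<Rightarrow> 'a) \<times> (('a + 'm) list \<Rightarrow> 'm)" where
  "inner_derivation a =
    (\<lambda>as. case as of [x] \<Rightarrow> a * x - x * a | _ \<Rightarrow> 0,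
     \<lambda>w. case w of [Inr u] \<Rightarrow> lact a u - ract u a | _ \<Rightarrow> 0)"

lemma inner_derivation_in_C_AssBimod: "inner_derivation a \<in> C_AssBimod scaleA scaleM 1"
  by (auto simp: inner_derivation_def C_AssBimod_def multilinear_def mixed_multilinear_def
      mixed_words_def Vector_Spaces.linear_iff A.vector_space_axioms M.vector_space_axioms
      length_Suc_conv lact_mod.add lact_mod.scale ract_mod.add ract_mod.scale
      M.scale_right_diff_distrib A.scale_right_diff_distrib scale_mult_left scale_mult_right
      distrib_left distrib_right split: list.split sum.split if_splits)

lemma mixed_words_2: "w \<in> mixed_words 2 \<longleftrightarrow> (\<exists>x u. w = [Inl x, Inr u] \<or> w = [Inr u, Inl x])"
proof
  assume "w \<in> mixed_words 2"
  then obtain x y where "w = [x, y]"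
    by (auto simp: mixed_words_def numeral_2_eq_2 length_Suc_conv)
  with \<open>w \<in> mixed_words 2\<close> show "\<exists>x u. w = [Inl x, Inr u] \<or> w = [Inr u, Inl x]"
    by (cases x; cases y) (auto simp: mixed_words_def)
qed (auto simp: mixed_words_def)

lemma inner_derivation_cocycle: "differential KB 1 (inner_derivation a) = 0"
proof -
  have "delta_Hoch scaleA 1 (fst (inner_derivation a)) as = 0" for as
  proof (cases "length as = 2")
    case True
    then obtain x y where "as = [x, y]"
      by (auto simp: numeral_2_eq_2 length_Suc_conv)
    then show ?thesis
      by (simp add: delta_Hoch_def inner_derivation_def algebra_simps)
  qed (simp add: delta_Hoch_def)
  moreover have "delta_Hoch_rel scaleM lact ract 1 (fst (inner_derivation a))
      (snd (inner_derivation a)) w = 0" for w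
  proof (cases "w \<in> mixed_words 2")
    case True
    then show ?thesis
      unfolding delta_Hoch_rel_def one_add_one
      by (auto simp: mixed_words_2[THEN iffD2] inner_derivation_def apply_sum_def algebra_simps
          lact_mod.diff ract_mod.diff lact_alg.diff ract_alg.diff lact_mult ract_mult lact_ract
          dest!: mixed_words_2[THEN iffD1])
  next
    case False
    then show ?thesis
      unfolding delta_Hoch_rel_def one_add_one by simp
  qed
  ultimately show ?thesis
    using complex_AssBimod_simps(2)[of 1 "fst (inner_derivation a)" "snd (inner_derivation a)"]
    by (simp add: fun_eq_iff zero_prod_def)
qed

text \<open>On the only tree with one vertex both outer actions are the corrected ones,
  \<open>Dashv\<close> on the left and \<open>Vdash\<close> on the right. Their main terms give the
  commutator with \<open>P u\<close>, and their corrections give \<open>P\<close> of the module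
  component of the derivation.\<close>

lemma delta_P_0_eq_h_P:
  assumes "\<gamma> \<in> CY scaleA scaleM 0"
  shows "delta_P scaleA lact ract P 0 \<gamma> = case_prod (h_P scaleA P 1) (inner_derivation (\<gamma> Leaf []))"
proof (intro ext)
  fix y and us :: "'m list"
  show "delta_P scaleA lact ract P 0 \<gamma> y us =
    case_prod (h_P scaleA P 1) (inner_derivation (\<gamma> Leaf [])) y us"
  proof (cases "y \<in> Y 1 \<and> length us = 1")
    case True
    then obtain u where "us = [u]"
      by (auto simp: length_Suc_conv)
    moreover have "y = Node Leaf Leaf"
      using True by (cases y) (auto simp: Y_def)
    ultimately show ?thesis
      by (simp add: delta_P_def h_P_def inner_derivation_def Y_def star_def P.diff algebra_simps)
  qed (auto simp: delta_P_def h_P_def inner_derivation_def)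
qed

end

section \<open>The long exact sequence\<close>

context relative_averaging_algebra
begin

sublocale KP: linear_cochain_sequence KP
  by (rule linear_cochain_sequence_P)

sublocale KB: linear_cochain_sequence KB
  by (rule linear_cochain_sequence_AssBimod)

sublocale KR: linear_cochain_sequence KR
  by (rule linear_cochain_sequence_rAvg)

lemma delta_P_0 [simp]: "delta_P scaleA lact ract P n 0 = 0"
  using KP.differential.zero by simp

lemma delta_Hoch_0 [simp]:
  "delta_Hoch scaleA n 0 = 0"
  "delta_Hoch_rel scaleM lact ract n 0 0 = 0"
  using KB.differential.zero[of n] by (simp_all add: zero_prod_def)

lemma linear_h_P: "Vector_Spaces.linear (scaling KB) (scaling KP) (case_prod (h_P scaleA P n))"
  using KB.vector_space_axioms KP.vector_space_axioms
  by (auto simp: Vector_Spaces.linear_iff h_P_add h_P_scale)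

lemma h_P_0 [simp]: "h_P scaleA P n 0 0 = 0"
  using module_hom.zero[OF linear_h_P[unfolded Vector_Spaces.module_hom_iff_linear[symmetric]]]
  by (simp add: zero_prod_def)

lemma h_P_diff: "h_P scaleA P n (f - f') (g - g') = h_P scaleA P n f g - h_P scaleA P n f' g'"
  using h_P_add[of n "f - f'" f' "g - g'" g'] by (simp add: algebra_simps)

lemma coboundaries_P_Suc:
  "coboundaries KP (Suc n) = delta_P scaleA lact ract P n ` CY scaleA scaleM n"
  by (simp add: coboundaries_def)

text \<open>In degree 1 the complex of the relative averaging algebra has no component from \<open>CY 0\<close>,
  so there the inclusion is replaced by zero.\<close>

definition \<iota>_map :: "nat \<Rightarrow> (pbtree \<Rightarrow> 'm list \<Rightarrow> 'a) \<Rightarrow>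
    ('a list \<Rightarrow> 'a) \<times> (('a + 'm) list \<Rightarrow> 'm) \<times> (pbtree \<Rightarrow> 'm list \<Rightarrow> 'a)" where
  "\<iota>_map n \<gamma> = (if n \<ge> 2 then (0, 0, \<gamma>) else 0)"

definition \<pi>_map :: "('a list \<Rightarrow> 'a) \<times> (('a + 'm) list \<Rightarrow> 'm) \<times> (pbtree \<Rightarrow> 'm list \<Rightarrow> 'a) \<Rightarrow>
    ('a list \<Rightarrow> 'a) \<times> (('a + 'm) list \<Rightarrow> 'm)" where
  "\<pi>_map = (\<lambda>(f, g, \<gamma>). (f, g))"

lemma coboundary_\<iota>:
  assumes "n \<ge> 2" "\<gamma> \<in> coboundaries KP (n - 1)"
  shows "(0, 0, \<gamma>) \<in> coboundaries KR n"
proof -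
  obtain m where n: "n = Suc (Suc m)"
    using assms(1) by (metis add_2_eq_Suc le_Suc_ex)
  then obtain \<beta> where \<beta>: "\<beta> \<in> CY scaleA scaleM m" "\<gamma> = delta_P scaleA lact ract P m \<beta>"
    using assms(2) by (auto simp: coboundaries_P_Suc)
  show ?thesis
  proof (cases m)
    case 0
    obtain f g where fg: "inner_derivation (\<beta> Leaf []) = (f, g)"
      by fastforce
    \<comment> \<open>Here \<open>n = 2\<close>. The obvious primitive
      \<open>(0, 0, \<beta>)\<close> is in general not a cochain of degree 1; the inner derivation
      replaces it.\<close>
    have "(f, g, 0) \<in> C_rAvg scaleA scaleM 1"
      using inner_derivation_in_C_AssBimod[of "\<beta> Leaf []"] by (simp add: C_rAvg_eq fg)
    moreover have "differential KR 1 (f, g, 0) = (0, 0, \<gamma>)"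
      using inner_derivation_cocycle[of "\<beta> Leaf []"] delta_P_0_eq_h_P[of \<beta>] \<beta> 0
      by (simp add: fg zero_prod_def)
    ultimately show ?thesis
      using n 0 by (force simp: coboundaries_def)
  next
    case (Suc k)
    then have "(0, 0, \<beta>) \<in> C_rAvg scaleA scaleM (Suc m)"
      using \<beta> KB.subspace_0[OF subspace_C_AssBimod] by (auto simp: C_rAvg_eq zero_prod_def)
    moreover have "differential KR (Suc m) (0, 0, \<beta>) = (0, 0, \<gamma>)"
      using \<beta> by simp
    ultimately show ?thesis
      using n by (force simp: coboundaries_def)
  qed
qed

lemma induces_\<iota>:
  assumes "n \<ge> 1"
  shows "induces_cohomology_map KP KR (\<iota>_map n) (n - 1) n"
proof (intro induces_cohomology_map.intro induces_cohomology_map_axioms.intro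
    KP.linear_cochain_sequence_axioms KR.linear_cochain_sequence_axioms)
  show "Vector_Spaces.linear (scaling KP) (scaling KR) (\<iota>_map n)"
    using KP.vector_space_axioms KR.vector_space_axioms
    by (auto simp: Vector_Spaces.linear_iff \<iota>_map_def zero_prod_def simp flip: zero_fun_def)
next
  fix z assume z: "z \<in> cocycles KP (n - 1)"
  show "\<iota>_map n z \<in> cocycles KR n"
  proof (cases "n \<ge> 2")
    case True
    then show ?thesis
      using z KB.subspace_0[OF subspace_C_AssBimod]
      by (auto simp: \<iota>_map_def cocycles_def C_rAvg_eq zero_prod_def)
  next
    case False
    then show ?thesis
      using KR.subspace_0[OF KR.subspace_cocycles] by (simp add: \<iota>_map_def)
  qed
next
  fix z assume "z \<in> coboundaries KP (n - 1)"
  then show "\<iota>_map n z \<in> coboundaries KR n"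
    using coboundary_\<iota> KR.subspace_0[OF KR.subspace_coboundaries] by (simp add: \<iota>_map_def)
qed

lemma induces_\<pi>:
  assumes "n \<ge> 1"
  shows "induces_cohomology_map KR KB \<pi>_map n n"
proof (intro induces_cohomology_map.intro induces_cohomology_map_axioms.intro
    KB.linear_cochain_sequence_axioms KR.linear_cochain_sequence_axioms)
  show "Vector_Spaces.linear (scaling KR) (scaling KB) \<pi>_map"
    using KB.vector_space_axioms KR.vector_space_axioms
    by (auto simp: Vector_Spaces.linear_iff \<pi>_map_def)
next
  fix z assume "z \<in> cocycles KR n"
  then show "\<pi>_map z \<in> cocycles KB n"
    by (auto simp: cocycles_def \<pi>_map_def C_rAvg_eq zero_prod_def)
next
  fix z assume "z \<in> coboundaries KR n"
  then obtain f g \<gamma> where "(f, g, \<gamma>) \<in> C_rAvg scaleA scaleM (n - 1)"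
    "z = differential KR (n - 1) (f, g, \<gamma>)"
    using assms by (auto simp: coboundaries_def)
  then have "(f, g) \<in> C_AssBimod scaleA scaleM (n - 1)" "\<pi>_map z = differential KB (n - 1) (f, g)"
    by (auto simp: C_rAvg_eq \<pi>_map_def)
  then show "\<pi>_map z \<in> coboundaries KB n"
    using assms by (simp add: coboundaries_def imageI del: complex_AssBimod_simps(2))
qed

lemma induces_\<kappa>:
  assumes "n \<ge> 1"
  shows "induces_cohomology_map KB KP (case_prod (h_P scaleA P n)) n n"
proof (intro induces_cohomology_map.intro induces_cohomology_map_axioms.intro
    KB.linear_cochain_sequence_axioms KP.linear_cochain_sequence_axioms linear_h_P)
  fix z assume "z \<in> cocycles KB n"
  then show "case_prod (h_P scaleA P n) z \<in> cocycles KP n"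
    using assms by (cases z) (auto simp: cocycles_def h_P_in_CY delta_P_h_P zero_prod_def)
next
  fix z assume "z \<in> coboundaries KB n"
  then obtain f g where fg: "(f, g) \<in> C_AssBimod scaleA scaleM (n - 1)"
    "z = differential KB (n - 1) (f, g)"
    using assms by (auto simp: coboundaries_def)
  show "case_prod (h_P scaleA P n) z \<in> coboundaries KP n"
  proof (cases "n = 1")
    case True
    \<comment> \<open>The only degree 0 cochain of \<open>KB\<close> is zero, hence
      \<open>z = 0\<close>.\<close>
    then show ?thesis
      using fg KP.subspace_0[OF KP.subspace_coboundaries]
      by (simp add: C_AssBimod_def zero_prod_def)
  next
    case False
    with assms obtain m where m: "n = Suc m" "m \<ge> 1"
      by (cases n) auto
    have "case_prod (h_P scaleA P n) z = - delta_P scaleA lact ract P m (h_P scaleA P m f g)"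
      using fg m by (simp add: delta_P_h_P)
    moreover have "delta_P scaleA lact ract P m (h_P scaleA P m f g) \<in> coboundaries KP n"
      using fg m by (simp add: coboundaries_P_Suc h_P_in_CY)
    ultimately show ?thesis
      using KP.subspace_neg[OF KP.subspace_coboundaries] by metis
  qed
qed

section \<open>Exactness at the three kinds of places\<close>

lemma exact_rAvg:
  assumes "n \<ge> 1"
  shows "exact_at (cohomology KP (n - 1)) (induced_map KR n (\<iota>_map n)) (cohomology KR n)
    (induced_map KB n \<pi>_map) (cohomology KB n)"
proof (rule exact_at_induced_map[OF induces_\<iota>[OF assms] induces_\<pi>[OF assms]])
  interpret \<iota>: induces_cohomology_map KP KR "\<iota>_map n" "n - 1" n
    by (rule induces_\<iota>[OF assms])
  interpret \<pi>: induces_cohomology_map KR KB \<pi>_map n n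
    by (rule induces_\<pi>[OF assms])
  fix z assume z: "z \<in> cocycles KR n"
  obtain f g \<gamma> where fgz: "z = (f, g, \<gamma>)"
    by (cases z)
  show "\<pi>_map z \<in> coboundaries KB n \<longleftrightarrow>
    (\<exists>x\<in>cocycles KP (n - 1). z - \<iota>_map n x \<in> coboundaries KR n)"
  proof
    assume "\<exists>x\<in>cocycles KP (n - 1). z - \<iota>_map n x \<in> coboundaries KR n"
    then obtain x where "z - \<iota>_map n x \<in> coboundaries KR n" by blast
    then have "\<pi>_map (z - \<iota>_map n x) \<in> coboundaries KB n"
      by (rule \<pi>.coboundary)
    also have "\<pi>_map (z - \<iota>_map n x) = \<pi>_map z"
      by (simp add: fgz \<pi>_map_def \<iota>_map_def zero_prod_def)
    finally show "\<pi>_map z \<in> coboundaries KB n" .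
  next
    assume "\<pi>_map z \<in> coboundaries KB n"
    then obtain f' g' where fg': "(f', g') \<in> C_AssBimod scaleA scaleM (n - 1)"
      "(f, g) = differential KB (n - 1) (f', g')"
      using assms by (auto simp: coboundaries_def fgz \<pi>_map_def)
    show "\<exists>x\<in>cocycles KP (n - 1). z - \<iota>_map n x \<in> coboundaries KR n"
    proof (cases "n = 1")
      case True
      \<comment> \<open>Coboundaries of \<open>KB\<close> in degree 1 vanish, so \<open>f\<close>
        and \<open>g\<close> do; \<open>\<gamma> = 0\<close> holds for every cochain of this
        degree.\<close>
      then have "z = 0"
        using fg' z by (simp add: C_AssBimod_def cocycles_def C_rAvg_eq fgz zero_prod_def)
      then have "z - \<iota>_map n 0 \<in> coboundaries KR n"
        using KR.subspace_0[OF KR.subspace_coboundaries] \<iota>.map.zero by simp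
      then show ?thesis
        using KP.subspace_0[OF KP.subspace_cocycles] by blast
    next
      case False
      with assms obtain m where m: "n = Suc m" "m \<ge> 1"
        by (cases n) auto
      \<comment> \<open>Subtracting the differential of \<open>(f', g', 0)\<close> from
        \<open>z\<close> kills the first two components and leaves this third one. Anticommutation
        turns the cocycle condition on \<open>z\<close> into the one on \<open>?x\<close>.\<close>
      let ?x = "\<gamma> - h_P scaleA P m f' g'"
      have "\<gamma> \<in> CY scaleA scaleM m"
        "delta_P scaleA lact ract P m \<gamma> + h_P scaleA P n f g = 0"
        using z m by (auto simp: cocycles_def fgz C_rAvg_eq zero_prod_def)
      moreover have "h_P scaleA P n f g = - delta_P scaleA lact ract P m (h_P scaleA P m f' g')"
        using fg' m by (simp add: delta_P_h_P)
      ultimately have "?x \<in> cocycles KP m"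
        using KP.subspace_diff[OF subspace_CY] h_P_in_CY[OF m(2)] fg' m KP.differential.diff[of m]
        by (simp add: cocycles_def)
      moreover have "z - \<iota>_map n ?x = differential KR m (f', g', 0)"
        using fg' m by (simp add: fgz \<iota>_map_def)
      moreover have "(f', g', 0) \<in> C_rAvg scaleA scaleM m"
        using fg' m KP.subspace_0[OF subspace_CY] by (simp add: C_rAvg_eq)
      then have "differential KR m (f', g', 0) \<in> coboundaries KR n"
        using m by (simp add: coboundaries_def imageI del: complex_rAvg_simps(2))
      ultimately show ?thesis
        using m by (metis diff_Suc_1)
    qed
  qed
qed

lemma exact_AssBimod:
  assumes "n \<ge> 2"
  shows "exact_at (cohomology KR n) (induced_map KB n \<pi>_map) (cohomology KB n)
    (induced_map KP n (case_prod (h_P scaleA P n))) (cohomology KP n)"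
proof -
  have n: "n \<ge> 1"
    using assms by simp
  interpret \<kappa>: induces_cohomology_map KB KP "case_prod (h_P scaleA P n)" n n
    by (rule induces_\<kappa>[OF n])
  obtain m where m: "n = Suc m" "m \<ge> 1"
    using assms by (cases n) auto
  show ?thesis
  proof (rule exact_at_induced_map[OF induces_\<pi>[OF n] induces_\<kappa>[OF n]])
    fix z assume z: "z \<in> cocycles KB n"
    obtain f g where fg: "z = (f, g)"
      by (cases z)
    show "case_prod (h_P scaleA P n) z \<in> coboundaries KP n \<longleftrightarrow>
      (\<exists>x\<in>cocycles KR n. z - \<pi>_map x \<in> coboundaries KB n)"
    proof
      assume "case_prod (h_P scaleA P n) z \<in> coboundaries KP n"
      then obtain \<gamma> where \<gamma>: "\<gamma> \<in> CY scaleA scaleM m"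
        "h_P scaleA P n f g = delta_P scaleA lact ract P m \<gamma>"
        using m by (auto simp: coboundaries_P_Suc fg)
      \<comment> \<open>The third component of the differential is a sum, so the primitive enters
        with a minus sign.\<close>
      then have "(f, g, - \<gamma>) \<in> cocycles KR n"
        using z m KP.subspace_neg[OF subspace_CY] KP.differential.neg[of m]
        by (simp add: cocycles_def fg C_rAvg_eq zero_prod_def)
      moreover have "z - \<pi>_map (f, g, - \<gamma>) \<in> coboundaries KB n"
        using KB.subspace_0[OF KB.subspace_coboundaries] by (simp add: fg \<pi>_map_def)
      ultimately show "\<exists>x\<in>cocycles KR n. z - \<pi>_map x \<in> coboundaries KB n"
        by blast
    next
      assume "\<exists>x\<in>cocycles KR n. z - \<pi>_map x \<in> coboundaries KB n"
      then obtain f' g' \<gamma> where x: "(f', g', \<gamma>) \<in> cocycles KR n"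
        "(f, g) - (f', g') \<in> coboundaries KB n"
        by (auto simp: fg \<pi>_map_def)
      have "\<gamma> \<in> CY scaleA scaleM m"
        "h_P scaleA P n f' g' = - delta_P scaleA lact ract P m \<gamma>"
        using x m by (auto simp: cocycles_def C_rAvg_eq zero_prod_def eq_neg_iff_add_eq_0 add.commute)
      then have "h_P scaleA P n f' g' \<in> coboundaries KP n"
        using m KP.subspace_neg[OF KP.subspace_coboundaries[of n]]
        by (simp add: coboundaries_P_Suc)
      \<comment> \<open>Splits \<open>h_P f g\<close> into its value on the coboundary
        \<open>(f - f', g - g')\<close> and its value on \<open>(f', g')\<close>.\<close>
      from KP.subspace_add[OF KP.subspace_coboundaries \<kappa>.coboundary[OF x(2)] this]
      show "case_prod (h_P scaleA P n) z \<in> coboundaries KP n"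
        by (simp add: fg h_P_diff)
    qed
  qed
qed

lemma exact_P:
  assumes "n \<ge> 1"
  shows "exact_at (cohomology KB n) (induced_map KP n (case_prod (h_P scaleA P n)))
    (cohomology KP n) (induced_map KR (n + 1) (\<iota>_map (n + 1))) (cohomology KR (n + 1))"
proof (rule exact_at_induced_map[OF induces_\<kappa>[OF assms]])
  show "induces_cohomology_map KP KR (\<iota>_map (n + 1)) n (n + 1)"
    using induces_\<iota>[of "n + 1"] by simp
next
  fix z assume z: "z \<in> cocycles KP n"
  have \<iota>: "\<iota>_map (Suc n) x = (0, 0, x)" for x
    using assms by (simp add: \<iota>_map_def)
  show "\<iota>_map (n + 1) z \<in> coboundaries KR (n + 1) \<longleftrightarrow>
    (\<exists>x\<in>cocycles KB n. z - case_prod (h_P scaleA P n) x \<in> coboundaries KP n)"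
  proof
    assume "\<iota>_map (n + 1) z \<in> coboundaries KR (n + 1)"
    then obtain f g \<gamma> where fg\<gamma>: "(f, g, \<gamma>) \<in> C_rAvg scaleA scaleM n"
      "(0, 0, z) = differential KR n (f, g, \<gamma>)"
      by (auto simp: coboundaries_def \<iota>)
    then have "(f, g) \<in> cocycles KB n"
      by (auto simp: cocycles_def C_rAvg_eq zero_prod_def)
    moreover have "z - h_P scaleA P n f g = delta_P scaleA lact ract P (n - 1) \<gamma>"
      using fg\<gamma> by simp
    moreover have "delta_P scaleA lact ract P (n - 1) \<gamma> \<in> coboundaries KP n"
    proof (cases "n = 1")
      case True
      then show ?thesis
        using fg\<gamma> KP.subspace_0[OF KP.subspace_coboundaries] by (simp add: C_rAvg_eq)
    next
      case False
      then show ?thesis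
        using fg\<gamma> assms by (simp add: C_rAvg_eq coboundaries_def)
    qed
    ultimately show "\<exists>x\<in>cocycles KB n. z - case_prod (h_P scaleA P n) x \<in> coboundaries KP n"
      by force
  next
    assume "\<exists>x\<in>cocycles KB n. z - case_prod (h_P scaleA P n) x \<in> coboundaries KP n"
    then obtain f g where fg: "(f, g) \<in> cocycles KB n"
      "z - h_P scaleA P n f g \<in> coboundaries KP n"
      by auto
    have "(0, 0, z - h_P scaleA P n f g) \<in> coboundaries KR (n + 1)"
      using fg assms by (intro coboundary_\<iota>) auto
    moreover have "(0, 0, h_P scaleA P n f g) \<in> coboundaries KR (n + 1)"
    proof -
      have "(f, g, 0) \<in> C_rAvg scaleA scaleM n"
        using fg KP.subspace_0[OF subspace_CY] by (simp add: C_rAvg_eq cocycles_def)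
      moreover have "differential KR n (f, g, 0) = (0, 0, h_P scaleA P n f g)"
        using fg by (simp add: cocycles_def zero_prod_def)
      ultimately show ?thesis
        by (force simp: coboundaries_def)
    qed
    ultimately have "(0, 0, z - h_P scaleA P n f g) + (0, 0, h_P scaleA P n f g) \<in>
        coboundaries KR (n + 1)"
      by (rule KR.subspace_add[OF KR.subspace_coboundaries])
    then show "\<iota>_map (n + 1) z \<in> coboundaries KR (n + 1)"
      by (simp add: \<iota>)
  qed
qed

end
text \<open>Exactness alone would leave freedom such as changes of sign; the formulas on
  representatives fix the maps. There is none for \<open>\<iota> 1\<close>, because
  \<open>(0, 0, \<gamma>)\<close> need not be a cochain of degree 1; the map used there is zero, in
  accordance with the injectivity of \<open>\<pi> 1\<close>.\<close>

theorem theorem5p11: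
  fixes scaleA :: "'k::field_char_0 \<Rightarrow> 'a::ring \<Rightarrow> 'a"
    and scaleM :: "'k \<Rightarrow> 'm::ab_group_add \<Rightarrow> 'm"
    and lact :: "'a \<Rightarrow> 'm \<Rightarrow> 'm"
    and ract :: "'m \<Rightarrow> 'a \<Rightarrow> 'm"
    and P :: "'m \<Rightarrow> 'a"
  assumes "relative_averaging_algebra scaleA scaleM lact ract P"
  shows "let KP = complex_P scaleA scaleM lact ract P;
             KR = complex_rAvg scaleA scaleM lact ract P;
             KB = complex_AssBimod scaleA scaleM lact ract
    in \<exists>\<iota> \<pi> \<kappa>.
      (\<forall>n\<ge>1.
         linear_map (cohomology KP (n - 1)) (cohomology KR n) (\<iota> n) \<and>
         linear_map (cohomology KR n) (cohomology KB n) (\<pi> n) \<and>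
         linear_map (cohomology KB n) (cohomology KP n) (\<kappa> n)) \<and>
      (\<forall>n\<ge>1. exact_at (cohomology KP (n - 1)) (\<iota> n) (cohomology KR n) (\<pi> n) (cohomology KB n)) \<and>
      (\<forall>n\<ge>2. exact_at (cohomology KR n) (\<pi> n) (cohomology KB n) (\<kappa> n) (cohomology KP n)) \<and>
      (\<forall>n\<ge>1. exact_at (cohomology KB n) (\<kappa> n) (cohomology KP n) (\<iota> (n + 1)) (cohomology KR (n + 1))) \<and>
      (\<forall>n\<ge>2. \<forall>\<gamma>\<in>cocycles KP (n - 1).
         \<iota> n (coh_class KP (n - 1) \<gamma>) = coh_class KR n (0, 0, \<gamma>)) \<and>
      (\<forall>n\<ge>1. \<forall>(f, g, \<gamma>)\<in>cocycles KR n.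
         \<pi> n (coh_class KR n (f, g, \<gamma>)) = coh_class KB n (f, g)) \<and>
      (\<forall>n\<ge>1. \<forall>(f, g)\<in>cocycles KB n.
         \<kappa> n (coh_class KB n (f, g)) = coh_class KP n (h_P scaleA P n f g))"
proof -
  interpret relative_averaging_algebra scaleA scaleM lact ract P
    by fact
  let ?\<iota> = "\<lambda>n. induced_map KR n (\<iota>_map n)" and ?\<pi> = "\<lambda>n. induced_map KB n \<pi>_map"
    and ?\<kappa> = "\<lambda>n. induced_map KP n (case_prod (h_P scaleA P n))"
  have \<iota>: "?\<iota> n (coh_class KP (n - 1) \<gamma>) = coh_class KR n (0, 0, \<gamma>)" if "n \<ge> 2" for n \<gamma>
    using induces_cohomology_map.induced_map_coh_class[OF induces_\<iota>[of n]] that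
    by (simp add: \<iota>_map_def)
  have \<pi>: "?\<pi> n (coh_class KR n (f, g, \<gamma>)) = coh_class KB n (f, g)" if "n \<ge> 1" for n f g \<gamma>
    using induces_cohomology_map.induced_map_coh_class[OF induces_\<pi>[OF that]]
    by (simp add: \<pi>_map_def)
  have \<kappa>: "?\<kappa> n (coh_class KB n (f, g)) = coh_class KP n (h_P scaleA P n f g)" if "n \<ge> 1" for n f g
    using induces_cohomology_map.induced_map_coh_class[OF induces_\<kappa>[OF that]] by simp
  note linear = induces_cohomology_map.linear_map_induced_map[OF induces_\<iota>]
    induces_cohomology_map.linear_map_induced_map[OF induces_\<pi>]
    induces_cohomology_map.linear_map_induced_map[OF induces_\<kappa>]
  show ?thesis
    unfolding Let_def
    by (rule exI[of _ ?\<iota>], rule exI[of _ ?\<pi>], rule exI[of _ ?\<kappa>])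
      (use linear exact_rAvg exact_AssBimod exact_P \<iota> \<pi> \<kappa> in
        \<open>intro conjI allI impI ballI; clarify?; simp only:\<close>)
qed

end
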